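(* Let $\mathcal{A}$ be a central, essential, supersolvable hyperplane arrangement in $\mathbb{R}^d$, let $F=\{X_i\}_{i=0}^d$ be a modular flag for $\mathcal{A}$, let $c_0$ be any chamber incident to $F$, and let $c$ be any other chamber. Then: (i) there is a unique minimal gallery $r_0$ from $c_0$ to $c$ incident to $F$; (ii) this $r_0$ is an $L_2$-accessible vertex of the graph $G_2(c_0,c)$, i.e. $d_{G_2(c_0,c)}(r_0,r)=|L_2(r_0,r)|$ for every minimal gallery $r$ from $c_0$ to $c$.
   Context: A central, essential arrangement $\mathcal{A}$ is a finite set of linear hyperplanes in $\mathbb{R}^d$ with common intersection $\{0\}$; $L_i$ is the set of codimension-$i$ intersections of its hyperplanes. Chambers are components of the complement; $L_1(c,c')$ is the set of hyperplanes separating $c,c'$. A minimal gallery is a shortest path in the graph on chambers with $c,c'$ adjacent iff $|L_1(c,c')|=1$; a minimal gallery from $c_0$ to $c$ crosses each hyperplane of $L_1(c_0,c)$ exactly once and is determined by the crossing order. $L_2(c_0,c)$ is the set of $X\in L_2$ all of whose containing hyperplanes lie in $L_1(c_0,c)$. For minimal galleries $r,r'$ from $c_0$ to $c$, $L_2(r,r')$ is the set of $X\in L_2(c_0,c)$ such that $r,r'$ cross the hyperplanes containing $X$ in different orders. $G_2(c_0,c)$ has the minimal galleries from $c_0$ to $c$ as vertices, $r,r'$ adjacent iff $|L_2(r,r')|=1$. A modular coatom is a line $\ell\in L_{d-1}$ such that for any distinct $H,H'\in\mathcal{A}$ not containing $\ell$, $\ell+(H\cap H')\in\mathcal{A}$.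 $\mathcal{A}$ is supersolvable if $d=1$ or it has a modular coatom $\ell$ with localization $\mathcal{A}_\ell=\{H/\ell:H\supseteq\ell\}$ in $\mathbb{R}^d/\ell$ supersolvable. A flag is a chain $\{0\}=X_0\subset\cdots\subset X_d=\mathbb{R}^d$ of intersection subspaces with $\dim X_i=i$; it is modular if $X_1$ is a modular coatom of $\mathcal{A}$ and each $X_i/X_{i-1}$ is a modular coatom of $\mathcal{A}_{X_{i-1}}$. A chamber is incident to a subspace $X$ if its closure meets $X$ in a set of dimension $\dim X$, and to $F$ if incident to every $X_i$. A minimal gallery from $c_0$ to $c$ is incident to $F$ if whenever $i<j$ it crosses all hyperplanes of $L_1(c_0,c)$ containing $X_j$ before any hyperplane of $L_1(c_0,c)$ containing $X_i$ but not $X_j$. *)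

theory Defs
  imports "HOL-Analysis.Analysis" "HOL-Library.Extended_Nat"
begin

definition walk :: "'v set \<Rightarrow> ('v \<Rightarrow> 'v \<Rightarrow> bool) \<Rightarrow> 'v list \<Rightarrow> bool" where
  "walk V E ps \<longleftrightarrow> ps \<noteq> [] \<and> set ps \<subseteq> V \<and>
     (\<forall>i. Suc i < length ps \<longrightarrow> E (ps ! i) (ps ! Suc i))"

text \<open>Graph distance (infinite if no walk exists).\<close>
definition graph_dist :: "'v set \<Rightarrow> ('v \<Rightarrow> 'v \<Rightarrow> bool) \<Rightarrow> 'v \<Rightarrow> 'v \<Rightarrow> enat" where
  "graph_dist V E u v =
     (INF ps \<in> {ps. walk V E ps \<and> hd ps = u \<and> last ps = v}. enat (length ps - 1))"

definition linear_hyperplane :: "'a::euclidean_space set \<Rightarrow> bool" where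
  "linear_hyperplane H \<longleftrightarrow> (\<exists>n. n \<noteq> 0 \<and> H = {x. n \<bullet> x = 0})"

definition central_essential_arr :: "'a::euclidean_space set set \<Rightarrow> bool" where
  "central_essential_arr A \<longleftrightarrow> finite A \<and> (\<forall>H\<in>A. linear_hyperplane H) \<and> \<Inter>A = {0}"

text \<open>Intersection subspaces (the empty intersection is the whole space).\<close>
definition Lat :: "'a::euclidean_space set set \<Rightarrow> 'a set set" where
  "Lat A = {\<Inter>S | S. S \<subseteq> A}"

definition Lcod :: "'a::euclidean_space set set \<Rightarrow> nat \<Rightarrow> 'a set set" where
  "Lcod A i = {X \<in> Lat A. dim X + i = DIM('a)}"

definition chambers :: "'a::euclidean_space set set \<Rightarrow> 'a set set" where
  "chambers A = components (- \<Union>A)"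

definition L1 :: "'a::euclidean_space set set \<Rightarrow> 'a set \<Rightarrow> 'a set \<Rightarrow> 'a set set" where
  "L1 A c c' = {H \<in> A. \<not> (\<exists>C\<in>components (- H). c \<subseteq> C \<and> c' \<subseteq> C)}"

definition chamber_adj :: "'a::euclidean_space set set \<Rightarrow> 'a set \<Rightarrow> 'a set \<Rightarrow> bool" where
  "chamber_adj A c c' \<longleftrightarrow> card (L1 A c c') = 1"

definition min_gallery :: "'a::euclidean_space set set \<Rightarrow> 'a set \<Rightarrow> 'a set \<Rightarrow> 'a set list \<Rightarrow> bool" where
  "min_gallery A c0 c r \<longleftrightarrow>
     walk (chambers A) (chamber_adj A) r \<and> hd r = c0 \<and> last r = c \<and>
     enat (length r - 1) = graph_dist (chambers A) (chamber_adj A) c0 c"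

definition crosses_before :: "'a::euclidean_space set set \<Rightarrow> 'a set list \<Rightarrow> 'a set \<Rightarrow> 'a set \<Rightarrow> bool" where
  "crosses_before A r H H' \<longleftrightarrow>
     (\<exists>i j. i < j \<and> Suc j < length r \<and> H \<in> L1 A (r ! i) (r ! Suc i) \<and> H' \<in> L1 A (r ! j) (r ! Suc j))"

definition L2_cc :: "'a::euclidean_space set set \<Rightarrow> 'a set \<Rightarrow> 'a set \<Rightarrow> 'a set set" where
  "L2_cc A c0 c = {X \<in> Lcod A 2. {H \<in> A. X \<subseteq> H} \<subseteq> L1 A c0 c}"

definition L2_gal :: "'a::euclidean_space set set \<Rightarrow> 'a set \<Rightarrow> 'a set \<Rightarrow> 'a set list \<Rightarrow> 'a set list \<Rightarrow> 'a set set" where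
  "L2_gal A c0 c r r' = {X \<in> L2_cc A c0 c. \<exists>H\<in>A. \<exists>H'\<in>A. H \<noteq> H' \<and> X \<subseteq> H \<and> X \<subseteq> H' \<and>
       crosses_before A r H H' \<and> crosses_before A r' H' H}"

definition G2_adj :: "'a::euclidean_space set set \<Rightarrow> 'a set \<Rightarrow> 'a set \<Rightarrow> 'a set list \<Rightarrow> 'a set list \<Rightarrow> bool" where
  "G2_adj A c0 c r r' \<longleftrightarrow> card (L2_gal A c0 c r r') = 1"

definition G2_dist :: "'a::euclidean_space set set \<Rightarrow> 'a set \<Rightarrow> 'a set \<Rightarrow> 'a set list \<Rightarrow> 'a set list \<Rightarrow> enat" where
  "G2_dist A c0 c r r' = graph_dist {r. min_gallery A c0 c r} (G2_adj A c0 c) r r'"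

text \<open>Relative modular coatom: \<open>Z/Y\<close> is a modular coatom (a line) of the localization
  \<open>A_Y\<close>, viewed in \<open>\<real>^d/Y\<close>. Quotient notions are pulled back to \<open>\<real>^d\<close>:
  lines of \<open>L(A_Y)/Y\<close> are subspaces \<open>Z \<in> L(A)\<close>, \<open>Z \<supseteq> Y\<close>, \<open>dim Z = dim Y + 1\<close>;
  hyperplanes of \<open>A_Y/Y\<close> are \<open>H/Y\<close> with \<open>H \<in> A\<close>, \<open>Y \<subseteq> H\<close>.
  For \<open>Y = {0}\<close> this is exactly the notion of a modular coatom of \<open>A\<close>.\<close>
definition modular_rel :: "'a::euclidean_space set set \<Rightarrow> 'a set \<Rightarrow> 'a set \<Rightarrow> bool" where
  "modular_rel A Y Z \<longleftrightarrow> Z \<in> Lat A \<and> Y \<subseteq> Z \<and> dim Z = dim Y + 1 \<and>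
     (\<forall>H\<in>A. \<forall>H'\<in>A. Y \<subseteq> H \<longrightarrow> Y \<subseteq> H' \<longrightarrow> H \<noteq> H' \<longrightarrow> \<not> Z \<subseteq> H \<longrightarrow> \<not> Z \<subseteq> H' \<longrightarrow>
        {z + w | z w. z \<in> Z \<and> w \<in> H \<inter> H'} \<in> A)"

definition modular_coatom :: "'a::euclidean_space set set \<Rightarrow> 'a set \<Rightarrow> bool" where
  "modular_coatom A l \<longleftrightarrow> modular_rel A {0} l"

text \<open>\<open>supersolvable_rel A Y\<close>: the localization \<open>A_Y\<close> in \<open>\<real>^d/Y\<close> is supersolvable
  (quotient dimension 1, or it has a modular coatom whose localization is supersolvable).\<close>
inductive supersolvable_rel :: "'a::euclidean_space set set \<Rightarrow> 'a set \<Rightarrow> bool" where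
  base: "dim Y + 1 = DIM('a) \<Longrightarrow> supersolvable_rel A Y"
| step: "modular_rel A Y Z \<Longrightarrow> supersolvable_rel A Z \<Longrightarrow> supersolvable_rel A Y"

definition supersolvable :: "'a::euclidean_space set set \<Rightarrow> bool" where
  "supersolvable A \<longleftrightarrow> supersolvable_rel A {0}"

definition modular_flag :: "'a::euclidean_space set set \<Rightarrow> (nat \<Rightarrow> 'a set) \<Rightarrow> bool" where
  "modular_flag A F \<longleftrightarrow> F 0 = {0} \<and> F DIM('a) = UNIV \<and>
     (\<forall>i\<le>DIM('a). F i \<in> Lat A \<and> dim (F i) = i) \<and>
     (\<forall>i. 0 < i \<and> i \<le> DIM('a) \<longrightarrow> F (i - 1) \<subset> F i \<and> modular_rel A (F (i - 1)) (F i))"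

definition incident :: "'a::euclidean_space set \<Rightarrow> 'a set \<Rightarrow> bool" where
  "incident c X \<longleftrightarrow> aff_dim (closure c \<inter> X) = int (dim X)"

definition chamber_incident_flag :: "'a::euclidean_space set \<Rightarrow> (nat \<Rightarrow> 'a set) \<Rightarrow> bool" where
  "chamber_incident_flag c F \<longleftrightarrow> (\<forall>i\<le>DIM('a). incident c (F i))"

definition gallery_incident_flag ::
  "'a::euclidean_space set set \<Rightarrow> 'a set \<Rightarrow> 'a set \<Rightarrow> (nat \<Rightarrow> 'a set) \<Rightarrow> 'a set list \<Rightarrow> bool" where
  "gallery_incident_flag A c0 c F r \<longleftrightarrow>
     (\<forall>i j H H'. i < j \<longrightarrow> j \<le> DIM('a) \<longrightarrow>
        H \<in> L1 A c0 c \<longrightarrow> F j \<subseteq> H \<longrightarrow>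
        H' \<in> L1 A c0 c \<longrightarrow> F i \<subseteq> H' \<longrightarrow> \<not> F j \<subseteq> H' \<longrightarrow>
        crosses_before A r H H')"

end

theory Submission
  imports Defs
begin

text \<open>
  The \<^emph>\<open>level\<close> of a hyperplane \<open>H\<close> is the largest \<open>j\<close> with \<open>F j \<subseteq> H\<close>. Choose
  \<open>v j\<close> in the closure of \<open>c0\<close> lying in \<open>F (j + 1)\<close> but not in \<open>F j\<close>, and normals \<open>N H\<close>, positive
  on \<open>c0\<close>, scaled so that \<open>N H \<bullet> v (lev H) = 1\<close>. Modularity then says that for
  distinct \<open>H\<close>, \<open>H'\<close> of equal level, \<open>N H - N H'\<close> is a multiple of \<open>N K\<close> for some \<open>K\<close> of higher
  level. Hence over a chamber of the hyperplanes of level above \<open>i\<close>, the hyperplanes of level \<open>i\<close> are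
  linearly ordered by the points at which a line in direction \<open>v i\<close> meets them. So a gallery
  crossing the hyperplanes in order of decreasing level exists (move back from \<open>c\<close> along the
  \<open>v i\<close>) and is unique.

  If a minimal gallery is not of this kind, consider its first ascent of levels, \<open>g\<close> followed
  by \<open>K\<close>. Up to then no level below that of \<open>g\<close> has been crossed, so from a point on the wall \<open>K\<close>
  one can move along \<open>v (lev g)\<close> until hitting \<open>X = g \<inter> K\<close>, staying on the same side of all hyperplanes
  not containing \<open>X\<close>. Therefore the hyperplanes through \<open>X\<close> are crossed consecutively, with \<open>K\<close>
  last, and this block can be reversed. As \<open>r0\<close> crosses \<open>K\<close> first among them, the reversal removes
  exactly \<open>X\<close> from \<open>L2(r0, r)\<close>.
\<close>

subsection \<open>The order of entries in a list\<close>

fun precedes :: "'b list \<Rightarrow> 'b \<Rightarrow> 'b \<Rightarrow> bool" where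
  "precedes [] a b = False"
| "precedes (x # xs) a b = (x = a \<and> b \<in> set xs \<or> precedes xs a b)"

lemma precedes_append:
  "precedes (xs @ ys) a b \<longleftrightarrow>
     precedes xs a b \<or> precedes ys a b \<or> a \<in> set xs \<and> b \<in> set ys"
  by (induction xs) auto

lemma precedes_rev: "precedes (rev xs) a b \<longleftrightarrow> precedes xs b a"
  by (induction xs) (auto simp: precedes_append)

lemma precedes_in_set: "precedes xs a b \<Longrightarrow> a \<in> set xs \<and> b \<in> set xs"
  by (induction xs) auto

lemma precedes_split: "precedes xs a b \<Longrightarrow> \<exists>us ws. xs = us @ a # ws \<and> b \<in> set ws"
proof (induction xs)
  case (Cons x xs)
  show ?case
  proof (cases "x = a \<and> b \<in> set xs")
    case True
    then show ?thesis by (metis append_Nil)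
  next
    case False
    then obtain us ws where "xs = us @ a # ws" "b \<in> set ws" using Cons by auto
    then show ?thesis by (metis append_Cons)
  qed
qed simp

lemma precedes_total:
  "a \<in> set xs \<Longrightarrow> b \<in> set xs \<Longrightarrow> a \<noteq> b \<Longrightarrow> precedes xs a b \<or> precedes xs b a"
  by (induction xs) auto

lemma precedes_asym: "distinct xs \<Longrightarrow> precedes xs a b \<Longrightarrow> \<not> precedes xs b a"
  by (induction xs) (auto dest: precedes_in_set)

lemma precedes_irrefl: "distinct xs \<Longrightarrow> \<not> precedes xs a a"
  by (induction xs) (auto dest: precedes_in_set)

lemma precedes_iff_nth:
  "precedes xs a b \<longleftrightarrow> (\<exists>i j. i < j \<and> j < length xs \<and> xs ! i = a \<and> xs ! j = b)"
proof (induction xs)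
  case (Cons x xs)
  show ?case
  proof
    assume "precedes (x # xs) a b"
    then consider "x = a" "b \<in> set xs" | "precedes xs a b" by auto
    then show "\<exists>i j. i < j \<and> j < length (x # xs) \<and> (x # xs) ! i = a \<and> (x # xs) ! j = b"
    proof cases
      case 1
      then obtain j where "j < length xs" "xs ! j = b" by (auto simp: in_set_conv_nth)
      then show ?thesis using 1 by (intro exI[of _ 0] exI[of _ "Suc j"]) auto
    next
      case 2
      then obtain i j where "i < j" "j < length xs" "xs ! i = a" "xs ! j = b" using Cons by auto
      then show ?thesis by (intro exI[of _ "Suc i"] exI[of _ "Suc j"]) auto
    qed
  next
    assume "\<exists>i j. i < j \<and> j < length (x # xs) \<and> (x # xs) ! i = a \<and> (x # xs) ! j = b"
    then obtain i j where ij: "i < j" "j < length (x # xs)" "(x # xs) ! i = a" "(x # xs) ! j = b"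
      by auto
    then obtain j' where j': "j = Suc j'" by (cases j) auto
    show "precedes (x # xs) a b"
    proof (cases i)
      case 0
      then show ?thesis using ij j' by auto
    next
      case (Suc i')
      then have "precedes xs a b" using ij j' Cons by auto
      then show ?thesis by simp
    qed
  qed
qed simp

lemma sorted_wrt_precedes: "sorted_wrt R xs \<Longrightarrow> precedes xs a b \<Longrightarrow> R a b"
  by (induction xs) auto

lemma sorted_wrt_if_precedes: "(\<And>a b. precedes xs a b \<Longrightarrow> R a b) \<Longrightarrow> sorted_wrt R xs"
  by (induction xs) auto

text \<open>If the heads \<open>x\<close> and \<open>y\<close> differed, \<open>x\<close> would
  precede \<open>y\<close> in \<open>xs\<close> while \<open>y\<close> precedes \<open>x\<close> in
  \<open>ys\<close>. This is how two orders of crossing are shown to coincide.\<close>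

lemma list_eq_if_precedes_compatible:
  assumes "distinct xs" "distinct ys" "set xs = set ys"
    and "\<And>a b. precedes xs a b \<Longrightarrow> \<not> precedes ys b a"
  shows "xs = ys"
  using assms
proof (induction xs arbitrary: ys)
  case (Cons x xs)
  then obtain y ys' where ys: "ys = y # ys'" by (cases ys) auto
  have "x = y"
  proof (rule ccontr)
    assume ne: "x \<noteq> y"
    have "y \<in> set xs" using Cons.prems(3) ys ne by auto
    moreover have "x \<in> set ys'" using Cons.prems(3) ys ne by auto
    ultimately show False using Cons.prems(4)[of x y] ys by simp
  qed
  moreover have "xs = ys'"
  proof (rule Cons.IH)
    show "set xs = set ys'" using Cons.prems(1-3) ys \<open>x = y\<close> by auto
    show "\<not> precedes ys' b a" if "precedes xs a b" for a b
      using Cons.prems(4)[of a b] that ys by simp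
  qed (use Cons.prems(1,2) ys in auto)
  ultimately show ?case using ys by simp
qed simp

text \<open>Reverse induction keeps an ascent that has already been found. If the new last entry
  creates the first one, then the previous last entry \<open>g\<close> has the least value so far
  and hence lies below it.\<close>

lemma first_ascent:
  fixes f :: "'b \<Rightarrow> nat"
  assumes "\<not> sorted_wrt (\<lambda>a b. f b \<le> f a) xs"
  shows "\<exists>us g k ws. xs = us @ g # k # ws \<and> sorted_wrt (\<lambda>a b. f b \<le> f a) (us @ [g]) \<and> f g < f k"
  using assms
proof (induction xs rule: rev_induct)
  case (snoc x xs)
  show ?case
  proof (cases "sorted_wrt (\<lambda>a b. f b \<le> f a) xs")
    case False
    then obtain us g k ws where "xs = us @ g # k # ws"
      "sorted_wrt (\<lambda>a b. f b \<le> f a) (us @ [g])" "f g < f k" using snoc by blast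
    then show ?thesis by (intro exI[of _ us] exI[of _ g] exI[of _ k] exI[of _ "ws @ [x]"]) auto
  next
    case True
    then obtain z where z: "z \<in> set xs" "f z < f x" using snoc.prems by (auto simp: sorted_wrt_append not_le)
    then obtain us g where us: "xs = us @ [g]" by (cases xs rule: rev_cases) auto
    have "f g \<le> f z" using True z(1) us by (auto simp: sorted_wrt_append)
    then show ?thesis using True us z(2)
      by (intro exI[of _ us] exI[of _ g] exI[of _ x] exI[of _ "[]"]) auto
  qed
qed simp

lemma set_dropWhile_upward_closed:
  assumes "\<And>a b. precedes xs a b \<Longrightarrow> Q a \<Longrightarrow> Q b"
  shows "\<forall>a\<in>set (dropWhile (\<lambda>a. \<not> Q a) xs). Q a"
  using assms
proof (induction xs)
  case (Cons x xs)
  show ?case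
  proof (cases "Q x")
    case True
    then have "Q b" if "b \<in> set xs" for b using that Cons.prems[of x b] by simp
    then show ?thesis using True by auto
  next
    case False
    then show ?thesis using Cons by auto
  qed
qed simp

lemma append_eq_append3_cases:
  assumes "us @ ws = P @ M @ Q"
  obtains z where "P = us @ z"
  | z z' where "us = P @ z" "M = z @ z'"
  | z z' where "us = P @ M @ z" "Q = z @ z'"
proof -
  from assms consider z where "P = us @ z" | z where "us = P @ z" "z @ ws = M @ Q"
    by (auto simp: append_eq_append_conv2)
  then show ?thesis
  proof cases
    case 1
    then show ?thesis by (rule that(1))
  next
    case 2
    from 2(2) consider z' where "M = z @ z'" | z' where "z = M @ z'" "Q = z' @ ws"
      by (auto simp: append_eq_append_conv2)
    then show ?thesis
    proof cases
      case 1
      then show ?thesis using that(2) 2(1) by blast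
    next
      case i: 2
      then show ?thesis using that(3)[of z' ws] 2(1) by simp
    qed
  qed
qed

subsection \<open>Sign regions of a family of hyperplanes\<close>

text \<open>\<open>T\<close> collects the hyperplanes whose negative side is taken. With normals
  positive on the base chamber, \<open>T = {}\<close> encodes that chamber, and for \<open>T\<close>
  contained in \<open>A\<close> with nonempty region it is the set of hyperplanes separating the
  region from the base.\<close>

definition sign_region :: "('a::euclidean_space set \<Rightarrow> 'a) \<Rightarrow> 'a set set \<Rightarrow> 'a set set \<Rightarrow> 'a set" where
  "sign_region N A T = {x. \<forall>H\<in>A. if H \<in> T then N H \<bullet> x < 0 else 0 < N H \<bullet> x}"

lemma convex_sign_region: "convex (sign_region N A T)"
proof -
  have "sign_region N A T = (\<Inter>H\<in>A. if H \<in> T then {x. N H \<bullet> x < 0} else {x. N H \<bullet> x > 0})"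
    by (auto simp: sign_region_def split: if_splits)
  also have "convex \<dots>"
    by (rule convex_INT) (auto simp: convex_halfspace_lt convex_halfspace_gt)
  finally show ?thesis .
qed

text \<open>Convexity gives connectedness. By the intermediate value theorem, a connected set
  avoiding all hyperplanes cannot contain points of opposite sign, so the region is maximal.\<close>

lemma sign_region_in_components:
  assumes "\<And>H. H \<in> A \<Longrightarrow> H = {x. N H \<bullet> x = 0}" and "sign_region N A T \<noteq> {}"
  shows "sign_region N A T \<in> components (- \<Union>A)"
  unfolding in_components_maximal
proof (intro conjI allI impI)
  let ?C = "sign_region N A T"
  show "?C \<noteq> {}" by fact
  show "?C \<subseteq> - \<Union>A"
  proof
    fix x assume x: "x \<in> ?C"
    have "x \<notin> H" if "H \<in> A" for H
    proof
      assume "x \<in> H"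
      then have "N H \<bullet> x = 0" using assms(1)[OF that] by blast
      then show False using x that by (force simp: sign_region_def split: if_splits)
    qed
    then show "x \<in> - \<Union>A" by blast
  qed
  show "connected ?C" by (rule convex_connected[OF convex_sign_region])
  fix D assume D: "D \<noteq> {} \<and> ?C \<subseteq> D \<and> D \<subseteq> - \<Union>A \<and> connected D"
  obtain x where x: "x \<in> ?C" using assms(2) by blast
  have "d \<in> ?C" if d: "d \<in> D" for d
    unfolding sign_region_def
  proof (intro CollectI ballI)
    fix H assume H: "H \<in> A"
    have xH: "if H \<in> T then N H \<bullet> x < 0 else 0 < N H \<bullet> x" using x H by (auto simp: sign_region_def)
    have nz: "N H \<bullet> z \<noteq> 0" if "z \<in> D" for z
      using that D H assms(1)[OF H] by blast
    show "if H \<in> T then N H \<bullet> d < 0 else 0 < N H \<bullet> d"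
    proof (rule ccontr)
      assume "\<not> ?thesis"
      then have "\<exists>z\<in>D. N H \<bullet> z = 0"
        using xH nz[OF d] D x d connected_ivt_hyperplane[of D x d "N H" 0]
          connected_ivt_hyperplane[of D d x "N H" 0] by (auto split: if_splits)
      then show False using nz by blast
    qed
  qed
  then show "D = ?C" using D by blast
qed

lemma components_arrangement:
  assumes "\<And>H. H \<in> A \<Longrightarrow> H = {x. N H \<bullet> x = 0}" and "c \<in> components (- \<Union>A)"
  shows "\<exists>T\<subseteq>A. c = sign_region N A T"
proof -
  obtain x where x: "x \<in> c" using assms(2) in_components_nonempty by blast
  define T where "T = {H\<in>A. N H \<bullet> x < 0}"
  have nz: "N H \<bullet> x \<noteq> 0" if "H \<in> A" for H
    using in_components_subset[OF assms(2)] x that assms(1)[OF that] by blast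
  have "x \<in> sign_region N A T" using nz by (force simp: sign_region_def T_def)
  moreover from this have "sign_region N A T \<in> components (- \<Union>A)"
    using assms(1) by (intro sign_region_in_components) auto
  ultimately have "c = sign_region N A T"
    using components_eq[OF assms(2)] x by blast
  then show ?thesis by (intro exI[of _ T]) (auto simp: T_def)
qed

section \<open>Auxiliary facts on vectors and real parameters\<close>

text \<open>The part \<open>e\<close> of \<open>b\<close> orthogonal to \<open>a\<close> is killed
  by \<open>a\<close>, hence by \<open>b\<close>, and so is orthogonal to itself.\<close>

lemma parallel_if_vanishes:
  fixes a b :: "'a::euclidean_space"
  assumes "\<And>x. a \<bullet> x = 0 \<Longrightarrow> b \<bullet> x = 0"
  shows "\<exists>k. b = k *\<^sub>R a"
proof -
  define e where "e = b - ((a \<bullet> b) / (a \<bullet> a)) *\<^sub>R a"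
  have "a \<bullet> e = 0" by (cases "a = 0") (auto simp: e_def inner_diff_right)
  then have "b \<bullet> e = 0" by (rule assms)
  then have "e \<bullet> e = 0" using \<open>a \<bullet> e = 0\<close>
    by (subst (1) e_def) (simp add: inner_diff_left)
  then show ?thesis by (auto simp: e_def)
qed

text \<open>Strict signs are open conditions on \<open>e\<close> near \<open>0\<close>, and only
  finitely many of them occur.\<close>

lemma perturbation:
  fixes N :: "'b \<Rightarrow> 'a::euclidean_space"
  assumes "finite A"
  shows "\<exists>e>0. \<forall>H\<in>A. (N H \<bullet> w > 0 \<longrightarrow> N H \<bullet> (w + e *\<^sub>R z) > 0) \<and>
                        (N H \<bullet> w < 0 \<longrightarrow> N H \<bullet> (w + e *\<^sub>R z) < 0)"
proof -
  have "\<forall>\<^sub>F e in at_right (0::real). (N H \<bullet> w > 0 \<longrightarrow> N H \<bullet> (w + e *\<^sub>R z) > 0) \<and>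
                        (N H \<bullet> w < 0 \<longrightarrow> N H \<bullet> (w + e *\<^sub>R z) < 0)" for H
  proof -
    have "((\<lambda>e. N H \<bullet> (w + e *\<^sub>R z)) \<longlongrightarrow> N H \<bullet> (w + 0 *\<^sub>R z)) (at_right 0)"
      by (intro tendsto_intros)
    then have lim: "((\<lambda>e. N H \<bullet> (w + e *\<^sub>R z)) \<longlongrightarrow> N H \<bullet> w) (at_right 0)" by simp
    show ?thesis
      using order_tendstoD[OF lim, of 0] by (auto intro!: eventually_conj simp: eventually_conj_iff)
  qed
  then have "\<forall>\<^sub>F e in at_right (0::real). \<forall>H\<in>A. (N H \<bullet> w > 0 \<longrightarrow> N H \<bullet> (w + e *\<^sub>R z) > 0) \<and>
                        (N H \<bullet> w < 0 \<longrightarrow> N H \<bullet> (w + e *\<^sub>R z) < 0)"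
    using assms by (intro eventually_ball_finite) auto
  then have "\<forall>\<^sub>F e in at_right (0::real). e > 0 \<and> (\<forall>H\<in>A. (N H \<bullet> w > 0 \<longrightarrow> N H \<bullet> (w + e *\<^sub>R z) > 0) \<and>
                        (N H \<bullet> w < 0 \<longrightarrow> N H \<bullet> (w + e *\<^sub>R z) < 0))"
    by (intro eventually_conj eventually_at_right_less)
  then show ?thesis by (metis (no_types, lifting) eventually_happens trivial_limit_at_right_real)
qed

text \<open>Supplies the length \<open>s\<close> of a shift along some \<open>v i\<close> after
  which the values in \<open>L\<close> are negative and those in \<open>U\<close> positive. Empty
  sets are split off because \<open>Max\<close> and \<open>Min\<close> say nothing about
  them.\<close>

lemma separating_real:
  fixes L U :: "real set"
  assumes "finite L" "finite U" "\<And>a b. a \<in> L \<Longrightarrow> b \<in> U \<Longrightarrow> a < b"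
  shows "\<exists>s. (\<forall>a\<in>L. a < s) \<and> (\<forall>b\<in>U. s < b)"
proof (cases "L = {}")
  case L: True
  have "\<forall>b\<in>U. Min U - 1 < b" using assms(2)
    by (metis Min_le diff_less_eq less_add_one order_le_less_trans)
  then show ?thesis using L by blast
next
  case L: False
  show ?thesis
  proof (cases "U = {}")
    case True
    have "\<forall>a\<in>L. a < Max L + 1" using assms(1) by (metis Max_ge less_add_one order_le_less_trans)
    then show ?thesis using True by auto
  next
    case False
    then have "Max L < Min U" using L assms by auto
    then obtain s where "Max L < s" "s < Min U" using dense by blast
    then show ?thesis using assms L False by (intro exI[of _ s]) auto
  qed
qed

subsection \<open>Minimal galleries as orders of crossing\<close>

lemma walk_snoc:
  "walk V E (ps @ [p]) \<longleftrightarrow> p \<in> V \<and> (ps = [] \<or> walk V E ps \<and> E (last ps) p)"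
proof (cases "ps = []")
  case True
  then show ?thesis by (auto simp: walk_def)
next
  case False
  have "(\<forall>i. Suc i < length (ps @ [p]) \<longrightarrow> E ((ps @ [p]) ! i) ((ps @ [p]) ! Suc i)) \<longleftrightarrow>
        (\<forall>i. Suc i < length ps \<longrightarrow> E (ps ! i) (ps ! Suc i)) \<and> E (last ps) p" (is "?L \<longleftrightarrow> ?R")
  proof
    assume L: ?L
    have "E (ps ! i) (ps ! Suc i)" if "Suc i < length ps" for i
      using L[rule_format, of i] that by (simp add: nth_append)
    moreover have "E (last ps) p"
      using L[rule_format, of "length ps - 1"] False by (simp add: nth_append last_conv_nth)
    ultimately show ?R by blast
  next
    assume R: ?R
    show ?L
    proof (intro allI impI)
      fix i assume i: "Suc i < length (ps @ [p])"
      show "E ((ps @ [p]) ! i) ((ps @ [p]) ! Suc i)"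
      proof (cases "Suc i < length ps")
        case True
        then show ?thesis using R by (simp add: nth_append)
      next
        case F: False
        then have "i = length ps - 1" "Suc i = length ps" using i by auto
        then show ?thesis using R False by (simp add: nth_append last_conv_nth)
      qed
    qed
  qed
  then show ?thesis using False by (auto simp: walk_def)
qed

lemma walk_last: "walk V E ps \<Longrightarrow> last ps \<in> V"
  unfolding walk_def using last_in_set by blast

locale oriented_arrangement =
  fixes A :: "'a::euclidean_space set set" and N :: "'a set \<Rightarrow> 'a"
  assumes finite_A: "finite A"
    and hyperplane_eq: "\<And>H. H \<in> A \<Longrightarrow> H = {x. N H \<bullet> x = 0}"
    and base_nonempty: "sign_region N A {} \<noteq> {}"
begin

abbreviation region :: "'a set set \<Rightarrow> 'a set" where
  "region \<equiv> sign_region N A"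

lemma region_neg: "x \<in> region T \<Longrightarrow> H \<in> A \<Longrightarrow> H \<in> T \<Longrightarrow> N H \<bullet> x < 0"
  and region_pos: "x \<in> region T \<Longrightarrow> H \<in> A \<Longrightarrow> H \<notin> T \<Longrightarrow> 0 < N H \<bullet> x"
  by (auto simp: sign_region_def split: if_splits)

lemma regionI:
  "(\<And>H. H \<in> A \<Longrightarrow> H \<in> T \<Longrightarrow> N H \<bullet> x < 0) \<Longrightarrow> (\<And>H. H \<in> A \<Longrightarrow> H \<notin> T \<Longrightarrow> 0 < N H \<bullet> x) \<Longrightarrow>
   x \<in> region T"
  by (auto simp: sign_region_def)

lemma region_in_chambers: "region T \<noteq> {} \<Longrightarrow> region T \<in> chambers A"
  unfolding chambers_def using hyperplane_eq by (rule sign_region_in_components)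

lemma chamber_region:
  assumes "c \<in> chambers A"
  obtains T where "T \<subseteq> A" "c = region T" "region T \<noteq> {}"
  using components_arrangement[of A N c, OF hyperplane_eq] assms in_components_nonempty
  unfolding chambers_def by metis

text \<open>The components of the complement of a single hyperplane are sign regions of
  \<open>{H}\<close>, so \<open>H\<close> fails to separate exactly when it has the same sign on
  both regions.\<close>

lemma L1_region:
  assumes T: "T \<subseteq> A" "region T \<noteq> {}" and T': "T' \<subseteq> A" "region T' \<noteq> {}"
  shows "L1 A (region T) (region T') = (T - T') \<union> (T' - T)"
proof -
  have "(\<exists>C\<in>components (- H). region T \<subseteq> C \<and> region T' \<subseteq> C) \<longleftrightarrow> (H \<in> T \<longleftrightarrow> H \<in> T')"
    if H: "H \<in> A" for H
  proof
    assume "\<exists>C\<in>components (- H). region T \<subseteq> C \<and> region T' \<subseteq> C"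
    then obtain C where C: "C \<in> components (- \<Union>{H})" "region T \<subseteq> C" "region T' \<subseteq> C" by auto
    obtain U where U: "C = sign_region N {H} U"
      using components_arrangement[of "{H}" N C] C(1) hyperplane_eq[OF H] by auto
    obtain x x' where x: "x \<in> region T" "x' \<in> region T'" using T T' by blast
    then have "x \<in> sign_region N {H} U" "x' \<in> sign_region N {H} U" using C U by auto
    then show "H \<in> T \<longleftrightarrow> H \<in> T'"
      using region_neg[OF x(1) H] region_pos[OF x(1) H] region_neg[OF x(2) H] region_pos[OF x(2) H]
      by (fastforce simp: sign_region_def split: if_splits)
  next
    assume eq: "H \<in> T \<longleftrightarrow> H \<in> T'"
    have sub: "region T \<subseteq> sign_region N {H} T" "region T' \<subseteq> sign_region N {H} T"
      using H eq by (auto simp: sign_region_def)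
    then have "sign_region N {H} T \<noteq> {}" using T by auto
    then have "sign_region N {H} T \<in> components (- \<Union>{H})"
      using hyperplane_eq[OF H] by (intro sign_region_in_components) auto
    then show "\<exists>C\<in>components (- H). region T \<subseteq> C \<and> region T' \<subseteq> C" using sub by auto
  qed
  then show ?thesis using T T' unfolding L1_def by blast
qed

text \<open>Each initial segment, from the empty one to all of \<open>S\<close>, has to be the sign
  pattern of an actual chamber. Such lists are the combinatorial form of the minimal galleries from
  \<open>region {}\<close> to \<open>region S\<close>; \<open>gallery_of\<close> translates
  back.\<close>

definition crossing_order :: "'a set set \<Rightarrow> 'a set list \<Rightarrow> bool" where
  "crossing_order S hs \<longleftrightarrow> distinct hs \<and> set hs = S \<and> S \<subseteq> A \<and>
     (\<forall>us ws. hs = us @ ws \<longrightarrow> region (set us) \<noteq> {})"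

definition gallery_of :: "'a set list \<Rightarrow> 'a set list" where
  "gallery_of hs = map (\<lambda>k. region (set (take k hs))) [0..<Suc (length hs)]"

lemma crossing_order_prefix: "crossing_order S hs \<Longrightarrow> hs = us @ ws \<Longrightarrow> region (set us) \<noteq> {}"
  by (auto simp: crossing_order_def)

lemma crossing_order_snoc:
  assumes "crossing_order S hs" "h \<in> A" "h \<notin> S" "region (insert h S) \<noteq> {}"
  shows "crossing_order (insert h S) (hs @ [h])"
  unfolding crossing_order_def
proof (intro conjI allI impI)
  fix us ws assume eq: "hs @ [h] = us @ ws"
  show "region (set us) \<noteq> {}"
  proof (cases ws rule: rev_cases)
    case Nil
    then show ?thesis using eq assms by (auto simp: crossing_order_def)
  next
    case (snoc ws' w)
    then have "hs = us @ ws'" using eq by simp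
    then show ?thesis using assms by (auto simp: crossing_order_def)
  qed
qed (use assms in \<open>auto simp: crossing_order_def\<close>)

lemma gallery_of_snoc: "gallery_of (hs @ [h]) = gallery_of hs @ [region (set (hs @ [h]))]"
  unfolding gallery_of_def by simp

lemma length_gallery_of: "length (gallery_of hs) = Suc (length hs)"
  by (simp add: gallery_of_def)

lemma nth_gallery_of: "k \<le> length hs \<Longrightarrow> gallery_of hs ! k = region (set (take k hs))"
  by (simp add: gallery_of_def del: upt_Suc)

lemma last_gallery_of: "last (gallery_of hs) = region (set hs)"
  by (simp add: gallery_of_def)

lemma hd_gallery_of: "hd (gallery_of hs) = region {}"
  by (simp add: gallery_of_def hd_map del: upt_Suc)

lemma L1_gallery_of:
  assumes "crossing_order S hs" "k < length hs"
  shows "L1 A (gallery_of hs ! k) (gallery_of hs ! Suc k) = {hs ! k}"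
proof -
  have d: "distinct hs" "set hs \<subseteq> A" using assms by (auto simp: crossing_order_def)
  have t: "set (take (Suc k) hs) = insert (hs ! k) (set (take k hs))"
    using assms(2) by (simp add: take_Suc_conv_app_nth)
  have "hs ! k \<notin> set (take k hs)"
    using d(1) assms(2) by (auto simp: in_set_conv_nth distinct_conv_nth)
  moreover have "region (set (take k hs)) \<noteq> {}" "region (set (take (Suc k) hs)) \<noteq> {}"
    using crossing_order_prefix[OF assms(1)] by (metis append_take_drop_id)+
  moreover have "set (take k hs) \<subseteq> A" "set (take (Suc k) hs) \<subseteq> A"
    using d(2) by (meson order_trans set_take_subset)+
  ultimately show ?thesis
    using assms(2) t by (simp add: nth_gallery_of L1_region) blast
qed

lemma crosses_before_gallery_of:
  assumes "crossing_order S hs"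
  shows "crosses_before A (gallery_of hs) H H' \<longleftrightarrow> precedes hs H H'"
proof -
  have "(i < j \<and> Suc j < length (gallery_of hs) \<and> H \<in> L1 A (gallery_of hs ! i) (gallery_of hs ! Suc i)
          \<and> H' \<in> L1 A (gallery_of hs ! j) (gallery_of hs ! Suc j)) \<longleftrightarrow>
        (i < j \<and> j < length hs \<and> hs ! i = H \<and> hs ! j = H')" for i j
    using L1_gallery_of[OF assms] by (auto simp: length_gallery_of)
  then show ?thesis unfolding crosses_before_def precedes_iff_nth by presburger
qed

lemma walk_gallery_of:
  assumes "crossing_order S hs"
  shows "walk (chambers A) (chamber_adj A) (gallery_of hs)"
  unfolding walk_def
proof (intro conjI allI impI)
  show "gallery_of hs \<noteq> []" by (metis length_gallery_of list.size(3) nat.distinct(1))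
  have "region (set (take k hs)) \<noteq> {}" for k
    using crossing_order_prefix[OF assms] by (metis append_take_drop_id)
  then show "set (gallery_of hs) \<subseteq> chambers A"
    using region_in_chambers unfolding gallery_of_def by (auto simp del: upt_Suc)
  show "chamber_adj A (gallery_of hs ! i) (gallery_of hs ! Suc i)"
    if "Suc i < length (gallery_of hs)" for i
    using that L1_gallery_of[OF assms, of i] by (simp add: length_gallery_of chamber_adj_def)
qed

lemma adjacent_regions:
  assumes "T \<subseteq> A" "region T \<noteq> {}" "T' \<subseteq> A" "region T' \<noteq> {}" "chamber_adj A (region T) (region T')"
  obtains h where "h \<in> A" "h \<notin> T" "T' = insert h T" | h where "h \<in> T" "T' = T - {h}"
proof -
  obtain h where h: "(T - T') \<union> (T' - T) = {h}"
    using assms L1_region[OF assms(1-4)] by (auto simp: chamber_adj_def card_1_singleton_iff)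
  show ?thesis
  proof (cases "h \<in> T")
    case True
    have "T' \<subseteq> T" using h True by (metis Diff_iff Un_iff singletonD subsetI)
    moreover have "T - {h} \<subseteq> T'" using h by (metis Diff_iff Un_iff singletonI subsetI)
    moreover have "h \<notin> T'" using h True by (metis Diff_iff Un_iff singletonI)
    ultimately have "T' = T - {h}" by auto
    then show ?thesis by (rule that(2)[OF True])
  next
    case False
    have "h \<in> T'" using h False by (metis DiffD1 Un_iff singletonI)
    moreover have "T \<subseteq> T'" using h False by (metis Diff_iff Un_iff singletonD subsetI)
    moreover have "T' \<subseteq> insert h T" using h by (metis Diff_iff Un_iff insertCI singletonD subsetI)
    ultimately have "T' = insert h T" "h \<in> A" using assms(3) by auto
    then show ?thesis by (intro that(1)[OF _ False])
  qed
qed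

lemma region_inj:
  assumes "T \<subseteq> A" "region T \<noteq> {}" "T' \<subseteq> A" "region T = region T'"
  shows "T = T'"
proof -
  obtain x where "x \<in> region T" "x \<in> region T'" using assms by auto
  then show ?thesis
    using region_neg[of x T] region_pos[of x T] region_neg[of x T'] region_pos[of x T'] assms(1,3)
    by (meson less_asym subsetD subsetI subset_antisym)
qed

text \<open>An adjacency step changes the separating set by one element, so at least
  \<open>card T\<close> steps are needed. The inequality is strict because \<open>length r\<close>
  counts chambers, one more than steps.\<close>

lemma walk_length_ge_card:
  assumes "walk (chambers A) (chamber_adj A) r" "hd r = region {}" "last r = region T"
    "T \<subseteq> A" "region T \<noteq> {}"
  shows "card T < length r"
  using assms
proof (induction r arbitrary: T rule: rev_induct)
  case Nil
  then have False by (meson walk_def)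
  then show ?case ..
next
  case (snoc c r)
  show ?case
  proof (cases "r = []")
    case True
    then have "region T = region {}" using snoc.prems(2,3) by (metis append_Nil last.simps list.sel(1))
    then have "T = {}" by (rule region_inj[OF snoc.prems(4,5) empty_subsetI])
    then show ?thesis by simp
  next
    case False
    then have w: "walk (chambers A) (chamber_adj A) r" "chamber_adj A (last r) c"
      using snoc.prems(1) by (auto simp: walk_snoc)
    then have "last r \<in> chambers A" using False by (auto simp: walk_def)
    then obtain T' where T': "T' \<subseteq> A" "last r = region T'" "region T' \<noteq> {}" by (rule chamber_region)
    have "card T' < length r" using snoc.IH[OF w(1) _ T'(2,1,3)] snoc.prems(2) False by simp
    moreover have "card T \<le> Suc (card T')"
      proof -
      have "finite T'" using T'(1) finite_A finite_subset by blast
      moreover have "chamber_adj A (region T') (region T)" using w(2) T'(2) snoc.prems(3) by simp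
      ultimately show ?thesis
        by (elim adjacent_regions[OF T'(1,3) snoc.prems(4,5)])
          (simp_all add: card_insert_if card_Diff_singleton_if le_SucI)
    qed
    ultimately show ?thesis by simp
  qed
qed

text \<open>Equality in the length bound leaves no room for recrossing a hyperplane, so every step
  adds a new one to the separating set.\<close>

lemma short_walk_gallery_of:
  assumes "walk (chambers A) (chamber_adj A) r" "hd r = region {}" "last r = region T"
    "T \<subseteq> A" "region T \<noteq> {}" "length r \<le> Suc (card T)"
  shows "\<exists>hs. crossing_order T hs \<and> r = gallery_of hs"
  using assms
proof (induction r arbitrary: T rule: rev_induct)
  case Nil
  then have False by (meson walk_def)
  then show ?case ..
next
  case (snoc c r)
  show ?case
  proof (cases "r = []")
    case True
    then have "region T = region {}" using snoc.prems(2,3) by (metis append_Nil last.simps list.sel(1))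
    then have "T = {}" by (rule region_inj[OF snoc.prems(4,5) empty_subsetI])
    then show ?thesis using True snoc.prems base_nonempty
      by (intro exI[of _ "[]"]) (auto simp: crossing_order_def gallery_of_def)
  next
    case False
    then have w: "walk (chambers A) (chamber_adj A) r" "chamber_adj A (last r) c"
      using snoc.prems(1) by (auto simp: walk_snoc)
    then have "last r \<in> chambers A" using False by (auto simp: walk_def)
    then obtain T' where T': "T' \<subseteq> A" "last r = region T'" "region T' \<noteq> {}" by (rule chamber_region)
    have c: "c = region T" "hd r = region {}" using snoc.prems False by auto
    have fin: "finite T'" using T'(1) finite_A finite_subset by blast
    have lt: "card T' < length r" using walk_length_ge_card[OF w(1) c(2) T'(2,1,3)] .
    have "chamber_adj A (region T') (region T)" using w(2) c T' by simp
    then obtain h where h: "h \<in> A" "h \<notin> T'" "T = insert h T'"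
    proof (rule adjacent_regions[OF T'(1,3) snoc.prems(4,5)])
      fix h assume "h \<in> T'" "T = T' - {h}"
      then have "card T < card T'" using fin by (metis card_Diff1_less)
      then show ?thesis using lt snoc.prems(6) by simp
    qed
    then have "length r \<le> Suc (card T')" using snoc.prems(6) fin by simp
    then obtain hs where hs: "crossing_order T' hs" "r = gallery_of hs"
      using snoc.IH[OF w(1) c(2) T'(2,1,3)] by blast
    have "crossing_order T (hs @ [h])"
      using crossing_order_snoc[OF hs(1) h(1,2)] snoc.prems(5) h(3) by simp
    moreover have "r @ [c] = gallery_of (hs @ [h])"
      using hs c h(3) by (simp add: gallery_of_snoc crossing_order_def)
    ultimately show ?thesis by blast
  qed
qed

lemma length_crossing_order: "crossing_order S hs \<Longrightarrow> length hs = card S"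
  by (auto simp: crossing_order_def distinct_card)

lemma graph_dist_regions:
  assumes "crossing_order S hs"
  shows "graph_dist (chambers A) (chamber_adj A) (region {}) (region S) = enat (card S)"
proof (rule antisym)
  have S: "S \<subseteq> A" "set hs = S" using assms by (auto simp: crossing_order_def)
  have ne: "region S \<noteq> {}" using crossing_order_prefix[OF assms, of hs "[]"] S by simp
  show "graph_dist (chambers A) (chamber_adj A) (region {}) (region S) \<le> enat (card S)"
    unfolding graph_dist_def
    using walk_gallery_of[OF assms] S length_crossing_order[OF assms]
    by (intro INF_lower2[of "gallery_of hs"])
      (auto simp: hd_gallery_of last_gallery_of length_gallery_of)
  show "enat (card S) \<le> graph_dist (chambers A) (chamber_adj A) (region {}) (region S)"
    unfolding graph_dist_def
  proof (rule INF_greatest)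
    fix ps assume "ps \<in> {ps. walk (chambers A) (chamber_adj A) ps \<and> hd ps = region {} \<and> last ps = region S}"
    then have "card S < length ps" using walk_length_ge_card S ne by blast
    then show "enat (card S) \<le> enat (length ps - 1)" by simp
  qed
qed

text \<open>The given order \<open>hs0\<close> fixes the graph distance at \<open>card S\<close>;
  minimal galleries are then the walks that attain the length bound.\<close>

lemma min_gallery_iff:
  assumes "crossing_order S hs0"
  shows "min_gallery A (region {}) (region S) r \<longleftrightarrow> (\<exists>hs. crossing_order S hs \<and> r = gallery_of hs)"
proof
  have S: "S \<subseteq> A" "set hs0 = S" using assms by (auto simp: crossing_order_def)
  have ne: "region S \<noteq> {}" using crossing_order_prefix[OF assms, of hs0 "[]"] S by simp
  assume r: "min_gallery A (region {}) (region S) r"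
  then have "length r \<le> Suc (card S)"
    using graph_dist_regions[OF assms] by (auto simp: min_gallery_def)
  then show "\<exists>hs. crossing_order S hs \<and> r = gallery_of hs"
    using r S ne by (intro short_walk_gallery_of) (auto simp: min_gallery_def)
next
  assume "\<exists>hs. crossing_order S hs \<and> r = gallery_of hs"
  then obtain hs where hs: "crossing_order S hs" "r = gallery_of hs" by blast
  then show "min_gallery A (region {}) (region S) r"
    using walk_gallery_of[OF hs(1)] graph_dist_regions[OF hs(1)] length_crossing_order[OF hs(1)]
    by (auto simp: min_gallery_def hd_gallery_of last_gallery_of length_gallery_of crossing_order_def)
qed

text \<open>The witness lies in the chamber entered by crossing \<open>a\<close>, with
  \<open>T\<close> the initial segment ending in \<open>a\<close>. Signs of linear relations between
  normals are read off at such points.\<close>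

lemma precedes_point:
  assumes "crossing_order S hs" "precedes hs a b"
  obtains x T where "x \<in> region T" "T \<subseteq> S" "a \<in> T" "b \<notin> T"
    "\<And>h. precedes hs h a \<Longrightarrow> h \<in> T" "\<And>h. precedes hs b h \<Longrightarrow> h \<notin> T"
    "\<And>h. precedes hs a h \<Longrightarrow> h \<notin> T"
proof -
  obtain us ws where hs: "hs = us @ a # ws" "b \<in> set ws" using precedes_split[OF assms(2)] by blast
  have d: "distinct hs" "set hs = S" using assms by (auto simp: crossing_order_def)
  obtain x where x: "x \<in> region (set (us @ [a]))"
    using crossing_order_prefix[OF assms(1), of "us @ [a]" ws] hs by auto
  show ?thesis
    by (rule that[OF x])
      (use hs d in \<open>auto simp: precedes_append dest: precedes_in_set\<close>)
qed

section \<open>Separation sets of galleries and the lower bound for distances\<close>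

lemma L2_gal_iff:
  assumes "crossing_order S hs" "crossing_order S hs'"
  shows "X \<in> L2_gal A (region {}) (region S) (gallery_of hs) (gallery_of hs') \<longleftrightarrow>
    X \<in> Lcod A 2 \<and> {H\<in>A. X \<subseteq> H} \<subseteq> S \<and>
    (\<exists>H\<in>A. \<exists>H'\<in>A. H \<noteq> H' \<and> X \<subseteq> H \<and> X \<subseteq> H' \<and> precedes hs H H' \<and> precedes hs' H' H)"
proof -
  have S: "S \<subseteq> A" "set hs = S" using assms by (auto simp: crossing_order_def)
  have "region S \<noteq> {}" using crossing_order_prefix[OF assms(1), of hs "[]"] S by simp
  then have "L1 A (region {}) (region S) = S" using L1_region[of "{}" S] base_nonempty S by auto
  then show ?thesis
    by (simp add: L2_gal_def L2_cc_def crosses_before_gallery_of[OF assms(1)]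
        crosses_before_gallery_of[OF assms(2)] conj_assoc)
qed

lemma finite_L2_gal: "finite (L2_gal A c c' r r')"
proof -
  have "Lat A = \<Inter> ` Pow A" by (auto simp: Lat_def)
  then have "finite (Lat A)" using finite_A by simp
  then show ?thesis by (rule finite_subset[rotated]) (auto simp: L2_gal_def L2_cc_def Lcod_def)
qed

text \<open>The intermediate gallery crosses \<open>H\<close> and \<open>H'\<close> in one of the
  two orders, so it disagrees with one of the outer galleries.\<close>

lemma L2_gal_triangle:
  assumes "crossing_order S hs" "crossing_order S hs'" "crossing_order S hs''"
  shows "L2_gal A (region {}) (region S) (gallery_of hs) (gallery_of hs'') \<subseteq>
    L2_gal A (region {}) (region S) (gallery_of hs) (gallery_of hs') \<union>
    L2_gal A (region {}) (region S) (gallery_of hs') (gallery_of hs'')"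
proof
  fix X assume "X \<in> L2_gal A (region {}) (region S) (gallery_of hs) (gallery_of hs'')"
  then obtain H H' where X: "X \<in> Lcod A 2" "{H\<in>A. X \<subseteq> H} \<subseteq> S"
    and H: "H \<in> A" "H' \<in> A" "H \<noteq> H'" "X \<subseteq> H" "X \<subseteq> H'" "precedes hs H H'" "precedes hs'' H' H"
    unfolding L2_gal_iff[OF assms(1,3)] by blast
  have "H \<in> set hs'" "H' \<in> set hs'"
    using precedes_in_set[OF H(6)] assms(1,2) by (auto simp: crossing_order_def)
  then have "precedes hs' H H' \<or> precedes hs' H' H" using H(3) by (rule precedes_total)
  then show "X \<in> L2_gal A (region {}) (region S) (gallery_of hs) (gallery_of hs') \<union>
    L2_gal A (region {}) (region S) (gallery_of hs') (gallery_of hs'')"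
  proof
    assume "precedes hs' H H'"
    then have "X \<in> L2_gal A (region {}) (region S) (gallery_of hs') (gallery_of hs'')"
      unfolding L2_gal_iff[OF assms(2,3)] using X H by (intro conjI bexI[of _ H] bexI[of _ H'])
    then show ?thesis ..
  next
    assume "precedes hs' H' H"
    then have "X \<in> L2_gal A (region {}) (region S) (gallery_of hs) (gallery_of hs')"
      unfolding L2_gal_iff[OF assms(1,2)] using X H by (intro conjI bexI[of _ H] bexI[of _ H'])
    then show ?thesis ..
  qed
qed

lemma L2_gal_same:
  assumes "crossing_order S hs"
  shows "L2_gal A (region {}) (region S) (gallery_of hs) (gallery_of hs) = {}"
  using L2_gal_iff[OF assms assms] precedes_asym[of hs] assms by (auto simp: crossing_order_def)

text \<open>An edge of \<open>G2\<close> contributes a single element, so by the triangle inclusion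
  the separation set grows by at most one per step.\<close>

lemma card_L2_gal_le_walk:
  assumes "crossing_order S hs0" "walk {r. min_gallery A (region {}) (region S) r} (G2_adj A (region {}) (region S)) ps"
    "hd ps = gallery_of hs0"
  shows "card (L2_gal A (region {}) (region S) (gallery_of hs0) (last ps)) \<le> length ps - 1"
  using assms(2,3)
proof (induction ps rule: rev_induct)
  case Nil
  then have False by (meson walk_def)
  then show ?case ..
next
  case (snoc r ps)
  show ?case
  proof (cases "ps = []")
    case True
    then show ?thesis using snoc.prems(2) L2_gal_same[OF assms(1)] by simp
  next
    case False
    then have ps: "walk {r. min_gallery A (region {}) (region S) r} (G2_adj A (region {}) (region S)) ps"
      "G2_adj A (region {}) (region S) (last ps) r" "min_gallery A (region {}) (region S) r"
      using snoc.prems(1) by (auto simp: walk_snoc)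
    have "min_gallery A (region {}) (region S) (last ps)" using walk_last[OF ps(1)] by simp
    then obtain hs' where hs': "crossing_order S hs'" "last ps = gallery_of hs'"
      using min_gallery_iff[OF assms(1)] by blast
    obtain hs where hs: "crossing_order S hs" "r = gallery_of hs"
      using ps(3) min_gallery_iff[OF assms(1)] by blast
    let ?L = "L2_gal A (region {}) (region S)"
    have "card (?L (gallery_of hs0) r) \<le> card (?L (gallery_of hs0) (last ps) \<union> ?L (last ps) r)"
      using L2_gal_triangle[OF assms(1) hs'(1) hs(1)] hs hs' finite_L2_gal by (intro card_mono) auto
    also have "\<dots> \<le> card (?L (gallery_of hs0) (last ps)) + card (?L (last ps) r)" by (rule card_Un_le)
    also have "\<dots> \<le> (length ps - 1) + 1"
      using snoc.IH[OF ps(1)] snoc.prems(2) False ps(2) unfolding G2_adj_def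
      by (intro add_mono) simp_all
    finally show ?thesis using False by (simp add: Suc_leI)
  qed
qed

end

subsection \<open>Arrangements with a modular flag\<close>

text \<open>Existence, uniqueness and the distance formula are derived from these four properties
  alone. \<open>v_nonneg\<close> reflects that the vectors \<open>v j\<close> lie in the closure of
  the base chamber; \<open>modular\<close> is modularity of the flag in terms of scaled
  normals.\<close>

locale flagged_arrangement = oriented_arrangement A N
  for A :: "'a::euclidean_space set set" and N :: "'a set \<Rightarrow> 'a" +
  fixes lev :: "'a set \<Rightarrow> nat" and v :: "nat \<Rightarrow> 'a"
  assumes v_zero: "H \<in> A \<Longrightarrow> j < lev H \<Longrightarrow> N H \<bullet> v j = 0"
    and v_one: "H \<in> A \<Longrightarrow> N H \<bullet> v (lev H) = 1"
    and v_nonneg: "H \<in> A \<Longrightarrow> H' \<in> A \<Longrightarrow> 0 \<le> N H \<bullet> v (lev H')"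
    and modular: "H \<in> A \<Longrightarrow> H' \<in> A \<Longrightarrow> H \<noteq> H' \<Longrightarrow> lev H = lev H' \<Longrightarrow>
      \<exists>K\<in>A. lev H < lev K \<and> (\<exists>k. N H - N H' = k *\<^sub>R N K)"
begin

lemma modularE:
  assumes "H \<in> A" "H' \<in> A" "H \<noteq> H'" "lev H = lev H'"
  obtains K k where "K \<in> A" "lev H < lev K" "k \<noteq> 0" "\<And>x. N H \<bullet> x - N H' \<bullet> x = k * (N K \<bullet> x)"
proof -
  obtain K k where K: "K \<in> A" "lev H < lev K" "N H - N H' = k *\<^sub>R N K"
    using modular[OF assms] by blast
  have eq: "N H \<bullet> x - N H' \<bullet> x = k * (N K \<bullet> x)" for x
    using K(3) by (metis inner_diff_left inner_scaleR_left)
  have "N H \<noteq> N H'" using hyperplane_eq[OF assms(1)] hyperplane_eq[OF assms(2)] assms(3) by auto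
  then have "k \<noteq> 0" using K(3) by auto
  then show ?thesis using that K eq by blast
qed

section \<open>Existence and uniqueness of the level-sorted order\<close>

text \<open>Move from \<open>p\<close> in direction \<open>v i\<close>, where \<open>i\<close> is
  the least level in \<open>T\<close>. Higher levels in \<open>T\<close> do not notice the move, and
  hyperplanes outside \<open>T\<close> stay positive by \<open>v_nonneg\<close>. The first one
  crossed is the \<open>h\<close> of level \<open>i\<close> with the largest value at
  \<open>p\<close>; ties are impossible, since by modularity the difference is a nonzero multiple of
  some \<open>N K\<close>, and \<open>p\<close> lies on no hyperplane.\<close>

lemma remove_lowest:
  assumes T: "T \<subseteq> A" "region T \<noteq> {}" "T \<noteq> {}"
  shows "\<exists>h\<in>T. region (T - {h}) \<noteq> {} \<and> (\<forall>H\<in>T. lev h \<le> lev H)"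
proof -
  have fin: "finite T" using T finite_A finite_subset by blast
  obtain p where p: "p \<in> region T" using T by blast
  define i where "i = Min (lev ` T)"
  define B where "B = {H\<in>T. lev H = i}"
  have "i \<in> lev ` T" unfolding i_def using fin T by (intro Min_in) auto
  then have "B \<noteq> {}" by (auto simp: B_def)
  moreover have finB: "finite B" using fin by (auto simp: B_def)
  ultimately have "Max ((\<lambda>H. N H \<bullet> p) ` B) \<in> (\<lambda>H. N H \<bullet> p) ` B" by (intro Max_in) auto
  then obtain h where hB: "h \<in> B" "Max ((\<lambda>H. N H \<bullet> p) ` B) = N h \<bullet> p" by auto
  have h: "h \<in> B" "N H \<bullet> p \<le> N h \<bullet> p" if "H \<in> B" for H
    using hB(1) finB that by (auto simp flip: hB(2))
  have hT: "h \<in> T" "lev h = i" "h \<in> A" using hB(1) T by (auto simp: B_def)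
  have ile: "i \<le> lev H" if "H \<in> T" for H using that fin by (simp add: i_def)
  have strict: "N H \<bullet> p < N h \<bullet> p" if H: "H \<in> B" "H \<noteq> h" for H
  proof -
    have HA: "H \<in> A" "lev H = lev h" using H T hT by (auto simp: B_def)
    obtain K k where K: "K \<in> A" "k \<noteq> 0" "\<And>x. N H \<bullet> x - N h \<bullet> x = k * (N K \<bullet> x)"
      using modularE[OF HA(1) hT(3) H(2) HA(2)] by metis
    have "N K \<bullet> p \<noteq> 0" using region_neg[OF p K(1)] region_pos[OF p K(1)] by fastforce
    then have "N H \<bullet> p \<noteq> N h \<bullet> p" using K(2) K(3)[of p] by auto
    then show ?thesis using h(2)[OF H(1)] by simp
  qed
  \<comment> \<open>Subtracting \<open>s\<close> from the values of level \<open>i\<close> turns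
    only that of \<open>h\<close> positive. As \<open>s\<close> is negative, this is a shift by a
    positive multiple of \<open>v i\<close>.\<close>
  obtain s where s: "\<forall>a\<in>(\<lambda>H. N H \<bullet> p) ` (B - {h}). a < s" "s < N h \<bullet> p"
    using separating_real[of "(\<lambda>H. N H \<bullet> p) ` (B - {h})" "{N h \<bullet> p}"] finB strict by auto
  have "N h \<bullet> p < 0" using region_neg[OF p] hT by auto
  then have s0: "s < 0" using s by simp
  have "p + (- s) *\<^sub>R v i \<in> region (T - {h})"
  proof (rule regionI)
    fix H assume H: "H \<in> A" "H \<in> T - {h}"
    then have neg: "N H \<bullet> p < 0" using region_neg[OF p] by auto
    show "N H \<bullet> (p + (- s) *\<^sub>R v i) < 0"
    proof (cases "lev H = i")
      case True
      then have "N H \<bullet> p < s" using s H by (auto simp: B_def)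
      then show ?thesis using v_one[OF H(1)] True by (simp add: inner_add_right inner_diff_right)
    next
      case False
      then have "i < lev H" using ile[of H] H by auto
      then show ?thesis using v_zero[OF H(1)] neg by (simp add: inner_add_right inner_diff_right)
    qed
  next
    fix H assume H: "H \<in> A" "H \<notin> T - {h}"
    show "0 < N H \<bullet> (p + (- s) *\<^sub>R v i)"
    proof (cases "H = h")
      case True
      then show ?thesis using v_one[OF H(1)] hT s by (simp add: inner_add_right inner_diff_right)
    next
      case False
      then have "0 < N H \<bullet> p" using region_pos[OF p] H by auto
      moreover have "0 \<le> (- s) * (N H \<bullet> v i)"
        using v_nonneg[OF H(1) hT(3)] hT s0 by (intro mult_nonneg_nonneg) auto
      ultimately show ?thesis by (simp add: inner_add_right inner_diff_right)
    qed
  qed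
  then show ?thesis using hT ile by blast
qed

abbreviation level_sorted :: "'a set list \<Rightarrow> bool" where
  "level_sorted \<equiv> sorted_wrt (\<lambda>a b. lev b \<le> lev a)"

text \<open>The order is built from its end, by walking from \<open>region S\<close> back to the
  base chamber and crossing a hyperplane of least level each time.\<close>

lemma ex_level_sorted_crossing_order:
  assumes "S \<subseteq> A" "region S \<noteq> {}"
  shows "\<exists>hs. crossing_order S hs \<and> level_sorted hs"
  using assms
proof (induction "card S" arbitrary: S)
  case 0
  then have "S = {}" using finite_A finite_subset by fastforce
  then show ?case using base_nonempty by (intro exI[of _ "[]"]) (auto simp: crossing_order_def)
next
  case (Suc n)
  then have "S \<noteq> {}" by auto
  then obtain h where h: "h \<in> S" "region (S - {h}) \<noteq> {}" "\<forall>H\<in>S. lev h \<le> lev H"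
    using remove_lowest[OF Suc.prems] by blast
  have "n = card (S - {h})" using Suc.hyps(2) h(1) by simp
  then obtain hs where hs: "crossing_order (S - {h}) hs" "level_sorted hs"
    using Suc.hyps(1)[of "S - {h}"] Suc.prems h by auto
  have "crossing_order (insert h (S - {h})) (hs @ [h])"
    using Suc.prems h hs by (intro crossing_order_snoc) (auto simp: insert_absorb)
  then have "crossing_order S (hs @ [h])" using h(1) by (simp add: insert_absorb)
  moreover have "level_sorted (hs @ [h])"
    using hs h(3) by (auto simp: sorted_wrt_append crossing_order_def)
  ultimately show ?case by blast
qed

text \<open>Right after the crossing of \<open>a\<close> the left side of the relation is negative,
  and so is \<open>N K\<close>. Thus, if \<open>K\<close> is crossed first, the sign of
  \<open>k\<close> decides the order of \<open>a\<close> and \<open>b\<close>.\<close>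

lemma order_after_crossing:
  assumes "crossing_order S hs" "precedes hs a b" "precedes hs K a"
    and "\<And>x. N a \<bullet> x - N b \<bullet> x = k * (N K \<bullet> x)"
  shows "0 < k"
proof -
  obtain x T where x: "x \<in> region T" "T \<subseteq> S" "a \<in> T" "b \<notin> T" "K \<in> T"
    using precedes_point[OF assms(1,2)] assms(3) by metis
  have "a \<in> A" "b \<in> A" "K \<in> A"
    using assms(1-3) by (auto simp: crossing_order_def dest: precedes_in_set)
  then have "k * (N K \<bullet> x) < 0" "N K \<bullet> x < 0"
    using x region_neg[OF x(1)] region_pos[OF x(1)] assms(4)[of x, symmetric] by force+
  then show ?thesis by (simp add: mult_less_0_iff)
qed

text \<open>The same point right after the crossing of \<open>a\<close> still has \<open>N K\<close>
  positive. Only the position of \<open>K\<close> relative to \<open>a\<close> matters, so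
  \<open>K\<close> may come before or after \<open>b\<close>.\<close>

lemma order_before_crossing:
  assumes "crossing_order S hs" "precedes hs a b" "K \<in> A" "K \<notin> S \<or> precedes hs a K"
    and "\<And>x. N a \<bullet> x - N b \<bullet> x = k * (N K \<bullet> x)"
  shows "k < 0"
proof -
  obtain x T where x: "x \<in> region T" "T \<subseteq> S" "a \<in> T" "b \<notin> T" "K \<notin> T"
    using precedes_point[OF assms(1,2)] assms(4) by (metis subsetD)
  have "a \<in> A" "b \<in> A"
    using assms(1-2) by (auto simp: crossing_order_def dest: precedes_in_set)
  then have "k * (N K \<bullet> x) < 0" "0 < N K \<bullet> x"
    using x assms(3) region_neg[OF x(1)] region_pos[OF x(1)] assms(5)[of x, symmetric] by force+
  then show ?thesis by (simp add: mult_less_0_iff)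
qed

lemma level_sorted_precedes:
  assumes "level_sorted hs" "a \<in> set hs" "b \<in> set hs" "lev b < lev a"
  shows "precedes hs a b"
proof (rule ccontr)
  assume "\<not> ?thesis"
  then have "precedes hs b a" using precedes_total[OF assms(2,3)] assms(4) by auto
  then show False using sorted_wrt_precedes[OF assms(1)] assms(4) by fastforce
qed

text \<open>Only hyperplanes \<open>a\<close>, \<open>b\<close> of equal level could be ordered
  differently. Their modular partner \<open>K\<close> has higher level, so both lists cross it
  before \<open>a\<close> and \<open>b\<close> or never; opposite orders would then give
  \<open>k\<close> and \<open>- k\<close> the same sign.\<close>

lemma level_sorted_unique:
  assumes hs: "crossing_order S hs" "level_sorted hs" and hs': "crossing_order S hs'" "level_sorted hs'"
  shows "hs = hs'"
proof (rule list_eq_if_precedes_compatible)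
  show "distinct hs" "distinct hs'" "set hs = set hs'" using hs hs' by (auto simp: crossing_order_def)
  fix a b assume ab: "precedes hs a b"
  show "\<not> precedes hs' b a"
  proof
    assume ba: "precedes hs' b a"
    have lev: "lev a = lev b"
      using sorted_wrt_precedes[OF hs(2) ab] sorted_wrt_precedes[OF hs'(2) ba] by simp
    have S: "set hs = S" "set hs' = S" "S \<subseteq> A" using hs hs' by (auto simp: crossing_order_def)
    have abS: "a \<in> S" "b \<in> S" using precedes_in_set[OF ab] S by auto
    have "a \<noteq> b" using ab precedes_irrefl[of hs] hs by (auto simp: crossing_order_def)
    then obtain K k where K: "K \<in> A" "lev a < lev K"
      and k: "\<And>x. N a \<bullet> x - N b \<bullet> x = k * (N K \<bullet> x)"
      using modularE[of a b] abS S lev by (metis subsetD)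
    have k': "N b \<bullet> x - N a \<bullet> x = (- k) * (N K \<bullet> x)" for x using k[of x] by simp
    show False
    proof (cases "K \<in> S")
      case True
      have "precedes hs K a" "precedes hs' K b"
        using level_sorted_precedes hs hs' True abS S K lev by metis+
      then show False
        using order_after_crossing[OF hs(1) ab _ k] order_after_crossing[OF hs'(1) ba _ k'] by simp
    next
      case False
      then show False
        using order_before_crossing[OF hs(1) ab K(1) _ k] order_before_crossing[OF hs'(1) ba K(1) _ k']
        by simp
    qed
  qed
qed

section \<open>Reversing the block at the first ascent\<close>

text \<open>The geometric core: \<open>Gs\<close> followed by \<open>K\<close> is the whole pencil
  of \<open>g \<inter> K\<close>, crossed consecutively, and the reversed block is again realised by
  chambers. The linear relations in the last conjunct serve later to compare orders inside
  \<open>Gs\<close>.\<close>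

lemma flip_first_ascent:
  assumes co: "crossing_order S hs" and ns: "\<not> level_sorted hs"
  shows "\<exists>P Gs K Q g. hs = P @ Gs @ K # Q \<and> crossing_order S (P @ K # rev Gs @ Q) \<and> g \<in> set Gs \<and>
    {H\<in>A. g \<inter> K \<subseteq> H} = insert K (set Gs) \<and> (\<forall>h\<in>set Gs. lev h < lev K) \<and>
    (\<forall>a\<in>set Gs. \<forall>b\<in>set Gs. a \<noteq> b \<longrightarrow> (\<exists>k. \<forall>x. N a \<bullet> x - N b \<bullet> x = k * (N K \<bullet> x)))"
proof -
  obtain U g K Q where hs: "hs = U @ g # K # Q" and sorted: "level_sorted (U @ [g])"
    and lev: "lev g < lev K" using first_ascent[OF ns] by blast
  define L where "L = U @ [g]"
  define i where "i = lev g"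
  have hsL: "hs = L @ K # Q" by (simp add: hs L_def)
  have dist: "distinct hs" "set hs = S" "S \<subseteq> A" using co by (auto simp: crossing_order_def)
  have KA: "K \<in> A" "K \<notin> set L" using dist hsL by auto
  have LA: "H \<in> A" if "H \<in> set L" for H using that dist hsL by auto
  have gL: "g \<in> set L" and gA: "g \<in> A" using LA by (auto simp: L_def)
  have sortL: "level_sorted L" using sorted by (simp add: L_def)
  have prec_g: "H = g \<or> precedes L H g" if "H \<in> set L" for H
    using that by (auto simp: L_def precedes_append)
  have ile: "i \<le> lev H" if "H \<in> set L" for H
    using prec_g[OF that] sorted_wrt_precedes[OF sortL] by (auto simp: i_def)
  have prec_hs: "precedes hs a b" if "precedes L a b" for a b using that by (simp add: hsL precedes_append)
  obtain x where x: "x \<in> region (set L)" using crossing_order_prefix[OF co hsL] by blast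
  obtain y where y: "y \<in> region (set (L @ [K]))"
    using crossing_order_prefix[OF co, of "L @ [K]" Q] hsL by auto
  have Kx: "0 < N K \<bullet> x" using region_pos[OF x KA] .
  have Ky: "N K \<bullet> y < 0" using region_neg[OF y KA(1)] by simp
  \<comment> \<open>a point of the common wall of the chambers before and after the crossing of \<open>K\<close>\<close>
  define w0 where "w0 = (- (N K \<bullet> y)) *\<^sub>R x + (N K \<bullet> x) *\<^sub>R y"
  have w0: "N H \<bullet> w0 = (- (N K \<bullet> y)) * (N H \<bullet> x) + (N K \<bullet> x) * (N H \<bullet> y)" for H
    by (simp add: w0_def inner_add_right inner_diff_right)
  have w0K: "N K \<bullet> w0 = 0" by (simp add: w0)
  have w0neg: "N H \<bullet> w0 < 0" if "H \<in> set L" for H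
    unfolding w0 using that LA[OF that] region_neg[OF x, of H] region_neg[OF y, of H] Kx Ky
    by (intro add_neg_neg mult_pos_neg) auto
  have w0pos: "0 < N H \<bullet> w0" if "H \<in> A" "H \<notin> set L" "H \<noteq> K" for H
    unfolding w0 using that region_pos[OF x, of H] region_pos[OF y, of H] Kx Ky
    by (intro add_pos_pos mult_pos_pos) auto
  \<comment> \<open>On the wall point \<open>w0\<close>, values of level \<open>i\<close> weakly
    increase in the order of crossing. The modular partner \<open>M\<close> is \<open>K\<close>,
    which vanishes there, or its sign at \<open>w0\<close> is opposite to that of \<open>k\<close>:
    sortedness of \<open>L\<close> puts \<open>M\<close> before \<open>a\<close> if it lies in
    \<open>L\<close>.\<close>
  have diff: "N a \<bullet> w0 \<le> N b \<bullet> w0"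
    if ab: "precedes L a b" "lev a = i" "lev b = i" for a b
  proof -
    have abL: "a \<in> set L" "b \<in> set L" using precedes_in_set[OF ab(1)] by auto
    have "a \<noteq> b" using ab(1) precedes_irrefl[of L] dist hsL by auto
    then obtain M k where M: "M \<in> A" "lev a < lev M" "k \<noteq> 0"
      and k: "\<And>x. N a \<bullet> x - N b \<bullet> x = k * (N M \<bullet> x)"
      using modularE[of a b] LA abL ab by metis
    show ?thesis
    proof (cases "M = K")
      case True
      then show ?thesis using k[of w0] w0K by simp
    next
      case False
      have "k * (N M \<bullet> w0) < 0"
      proof (cases "M \<in> set L")
        case True
        then have "precedes hs M a" using prec_hs level_sorted_precedes[OF sortL True abL(1)] M by simp
        then have "0 < k" using order_after_crossing[OF co prec_hs[OF ab(1)] _ k] by simp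
        then show ?thesis using w0neg[OF True] by (simp add: mult_pos_neg)
      next
        case nM: False
        then have "M \<notin> S \<or> precedes hs a M" using abL dist(2) by (auto simp: hsL precedes_append)
        then have "k < 0" using order_before_crossing[OF co prec_hs[OF ab(1)] M(1) _ k] by simp
        then show ?thesis using w0pos[OF M(1) nM False] by (simp add: mult_neg_pos)
      qed
      then show ?thesis using k[of w0] by simp
    qed
  qed
  \<comment> \<open>Equal values at \<open>w0\<close> mean that the line through \<open>w0\<close>
    in direction \<open>v i\<close> meets both hyperplanes in the same point. Within
    \<open>L\<close> this will turn out to select the hyperplanes through
    \<open>g \<inter> K\<close>.\<close>
  define Pen where "Pen H \<longleftrightarrow> lev H = i \<and> N H \<bullet> w0 = N g \<bullet> w0" for H
  have le_g: "N H \<bullet> w0 \<le> N g \<bullet> w0" if "H \<in> set L" "lev H = i" for H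
    using prec_g[OF that(1)]
  proof
    assume "precedes L H g"
    then show ?thesis using that(2) by (rule diff) (simp add: i_def)
  qed simp
  \<comment> \<open>Both the level and the value at \<open>w0\<close> are squeezed between those of
    \<open>a\<close> and those of the last entry \<open>g\<close>. Hence \<open>Pen\<close> holds on
    a final segment of \<open>L\<close>, which becomes \<open>Gs\<close>.\<close>
  have mono: "Pen b" if ab: "precedes L a b" "Pen a" for a b
  proof -
    have bL: "b \<in> set L" using precedes_in_set[OF ab(1)] by simp
    have "lev b = i" using sorted_wrt_precedes[OF sortL ab(1)] ile[OF bL] ab(2) by (simp add: Pen_def)
    moreover from this have "N b \<bullet> w0 = N g \<bullet> w0"
      using diff[OF ab(1)] le_g[OF bL] ab(2) by (simp add: Pen_def)
    ultimately show ?thesis by (simp add: Pen_def)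
  qed
  define P where "P = takeWhile (\<lambda>a. \<not> Pen a) L"
  define Gs where "Gs = dropWhile (\<lambda>a. \<not> Pen a) L"
  have LPG: "L = P @ Gs" by (simp add: P_def Gs_def)
  have Pnot: "\<not> Pen h" if "h \<in> set P" for h using that set_takeWhileD unfolding P_def by metis
  have GPen: "Pen h" if "h \<in> set Gs" for h
    using set_dropWhile_upward_closed[of L Pen] mono that unfolding Gs_def by blast
  have gG: "g \<in> set Gs" using gL Pnot[of g] LPG by (auto simp: Pen_def i_def)
  have GA: "h \<in> A" "h \<in> set L" if "h \<in> set Gs" for h using that LPG LA by auto
  have pencil: "\<exists>k. \<forall>x. N a \<bullet> x - N b \<bullet> x = k * (N K \<bullet> x)"
    if ab: "a \<in> set Gs" "b \<in> set Gs" "a \<noteq> b" for a b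
  proof -
    obtain M k where M: "M \<in> A" "k \<noteq> 0" and k: "\<And>x. N a \<bullet> x - N b \<bullet> x = k * (N M \<bullet> x)"
      using modularE[of a b] GA ab GPen by (metis Pen_def)
    \<comment> \<open>Equal values at \<open>w0\<close> force the modular partner to vanish there,
      and \<open>K\<close> is the only hyperplane of \<open>A\<close> through
      \<open>w0\<close>.\<close>
    have "N M \<bullet> w0 = 0" using k[of w0] GPen ab M(2) by (simp add: Pen_def)
    then have "M = K" using w0neg[of M] w0pos[OF M(1)] by force
    then show ?thesis using k by blast
  qed
  \<comment> \<open>the shift of \<open>w0\<close> in direction \<open>v i\<close> that lies on \<open>g \<inter> K\<close>\<close>
  define w where "w = w0 + (- (N g \<bullet> w0)) *\<^sub>R v i"
  have w: "N H \<bullet> w = N H \<bullet> w0 + (- (N g \<bullet> w0)) * (N H \<bullet> v i)" for H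
    by (simp add: w_def inner_add_right inner_diff_right)
  have wK: "N K \<bullet> w = 0" using w0K v_zero[OF KA(1), of i] lev by (simp add: w i_def)
  have wG: "N H \<bullet> w = 0" if "H \<in> set Gs" for H
    using GPen[OF that] v_one[OF GA(1)[OF that]] by (simp add: w Pen_def)
  \<comment> \<open>The shift is by a positive amount. It stops when \<open>g\<close> is reached,
    before any level \<open>i\<close> hyperplane with a smaller value at \<open>w0\<close>; higher
    levels in \<open>L\<close> are unaffected, and hyperplanes outside \<open>L\<close> other than
    \<open>K\<close> can only gain.\<close>
  have wneg: "N H \<bullet> w < 0" if "H \<in> set P" for H
  proof -
    have HL: "H \<in> set L" using that LPG by simp
    show ?thesis
    proof (cases "lev H = i")
      case True
      then have "N H \<bullet> w0 < N g \<bullet> w0" using le_g[OF HL] Pnot[OF that] by (auto simp: Pen_def)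
      then show ?thesis using v_one[OF LA[OF HL]] True by (simp add: w)
    next
      case False
      then have "i < lev H" using ile[OF HL] by simp
      then show ?thesis using v_zero[OF LA[OF HL]] w0neg[OF HL] by (simp add: w)
    qed
  qed
  have wpos: "0 < N H \<bullet> w" if "H \<in> A" "H \<notin> set L" "H \<noteq> K" for H
  proof -
    have "0 \<le> (- (N g \<bullet> w0)) * (N H \<bullet> v i)"
      using w0neg[OF gL] v_nonneg[OF that(1) gA] by (intro mult_nonneg_nonneg) (auto simp: i_def)
    then show ?thesis using w0pos[OF that] by (simp only: w)
  qed
  have pen_eq: "{H\<in>A. g \<inter> K \<subseteq> H} = insert K (set Gs)"
  proof (intro equalityI subsetI)
    fix H assume "H \<in> {H\<in>A. g \<inter> K \<subseteq> H}"
    then have H: "H \<in> A" "g \<inter> K \<subseteq> H" by auto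
    \<comment> \<open>The single point \<open>w\<close> decides this inclusion: no hyperplane
      outside the block passes through it.\<close>
    have "w \<in> g" "w \<in> K" using hyperplane_eq[OF gA] hyperplane_eq[OF KA(1)] wK wG[OF gG] by auto
    then have "N H \<bullet> w = 0" using H hyperplane_eq[OF H(1)] by auto
    then show "H \<in> insert K (set Gs)" using wneg[of H] wpos[OF H(1)] LPG by force
  next
    fix H assume H: "H \<in> insert K (set Gs)"
    show "H \<in> {H\<in>A. g \<inter> K \<subseteq> H}"
    proof (cases "H = K \<or> H = g")
      case True
      then show ?thesis using KA gA by auto
    next
      case False
      then have HG: "H \<in> set Gs" using H by simp
      then obtain k where k: "\<forall>x. N H \<bullet> x - N g \<bullet> x = k * (N K \<bullet> x)"
        using pencil[OF HG gG] False by auto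
      have "z \<in> H" if "z \<in> g" "z \<in> K" for z
      proof -
        have "N g \<bullet> z = 0" "N K \<bullet> z = 0" using that hyperplane_eq[OF gA] hyperplane_eq[OF KA(1)] by auto
        then have "N H \<bullet> z = 0" using k[rule_format, of z] by simp
        then show ?thesis using hyperplane_eq[OF GA(1)[OF HG]] by auto
      qed
      then show ?thesis using GA HG by auto
    qed
  qed
  \<comment> \<open>After the crossing of \<open>K\<close>, at \<open>y\<close>, hyperplanes crossed
    earlier in \<open>Gs\<close> have larger values, so those of \<open>G1\<close> lie below those
    of \<open>G2\<close>. A shift of \<open>y\<close> along \<open>v i\<close>, invisible to
    \<open>K\<close>, makes the former negative and the latter positive; a small step from
    \<open>w\<close> in the direction of the result carries these signs over.\<close>
  have prefix: "region (set (P @ K # G1)) \<noteq> {}" if G12: "rev Gs = G1 @ G2" for G1 G2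
  proof -
    have Gs: "Gs = rev G2 @ rev G1" using G12 by (metis rev_append rev_rev_ident)
    have lt: "N b \<bullet> y < N a \<bullet> y" if "a \<in> set G2" "b \<in> set G1" for a b
    proof -
      have ab: "a \<in> set Gs" "b \<in> set Gs" "precedes hs a b" "precedes hs a K"
        using that by (auto simp: hsL LPG Gs precedes_append)
      have "a \<noteq> b" using ab(3) precedes_irrefl[OF dist(1)] by auto
      then obtain k where k: "\<And>x. N a \<bullet> x - N b \<bullet> x = k * (N K \<bullet> x)" using pencil[OF ab(1,2)] by blast
      then have "k < 0" using order_before_crossing[OF co ab(3) KA(1) _ k] ab(4) by blast
      then have "0 < k * (N K \<bullet> y)" using Ky by (simp add: mult_neg_neg)
      then show ?thesis using k[of y] by simp
    qed
    obtain s where s: "\<forall>c\<in>(\<lambda>b. N b \<bullet> y) ` set G1. c < s" "\<forall>c\<in>(\<lambda>a. N a \<bullet> y) ` set G2. s < c"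
      using separating_real[of "(\<lambda>b. N b \<bullet> y) ` set G1" "(\<lambda>a. N a \<bullet> y) ` set G2"] lt by auto
    define z where "z = y + (- s) *\<^sub>R v i"
    have zG: "N H \<bullet> z = N H \<bullet> y - s" if "H \<in> set Gs" for H
      using GPen[OF that] v_one[OF GA(1)[OF that]] by (simp add: z_def inner_diff_right Pen_def)
    have zK: "N K \<bullet> z < 0"
      using Ky v_zero[OF KA(1), of i] lev by (simp add: z_def i_def inner_diff_right)
    obtain e where e: "e > 0" "\<And>H. H \<in> A \<Longrightarrow> (N H \<bullet> w > 0 \<longrightarrow> N H \<bullet> (w + e *\<^sub>R z) > 0) \<and>
                        (N H \<bullet> w < 0 \<longrightarrow> N H \<bullet> (w + e *\<^sub>R z) < 0)"
      using perturbation[OF finite_A, of N w z] by blast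
    \<comment> \<open>near \<open>w\<close> only the hyperplanes through \<open>g \<inter> K\<close> matter, and these see the signs of \<open>z\<close>\<close>
    have "w + e *\<^sub>R z \<in> region (set (P @ K # G1))"
    proof (rule regionI)
      fix H assume H: "H \<in> A" "H \<in> set (P @ K # G1)"
      then consider "H \<in> set P" | "H = K" | "H \<in> set G1" by auto
      then show "N H \<bullet> (w + e *\<^sub>R z) < 0"
      proof cases
        case 1
        then show ?thesis using wneg e(2)[OF H(1)] by blast
      next
        case 2
        then show ?thesis using wK zK e(1) by (simp add: inner_add_right mult_pos_neg)
      next
        case 3
        then have "H \<in> set Gs" "N H \<bullet> y < s" using Gs s(1) by auto
        then show ?thesis using wG zG e(1) by (simp add: inner_add_right mult_pos_neg)
      qed
    next
      fix H assume H: "H \<in> A" "H \<notin> set (P @ K # G1)"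
      show "0 < N H \<bullet> (w + e *\<^sub>R z)"
      proof (cases "H \<in> set G2")
        case True
        then have "H \<in> set Gs" "s < N H \<bullet> y" using Gs s(2) by auto
        then show ?thesis using wG zG e(1) by (simp add: inner_add_right inner_diff_right)
      next
        case False
        then have "H \<notin> set L" "H \<noteq> K" using H LPG Gs by auto
        then show ?thesis using wpos[OF H(1)] e(2)[OF H(1)] by blast
      qed
    qed
    then show ?thesis by blast
  qed
  have hs4: "hs = P @ Gs @ K # Q" by (simp add: hsL LPG)
  have "crossing_order S (P @ K # rev Gs @ Q)"
    unfolding crossing_order_def
  proof (intro conjI allI impI)
    show "distinct (P @ K # rev Gs @ Q)" using dist(1) hs4 by auto
    show "set (P @ K # rev Gs @ Q) = S" using dist(2) hs4 by auto
    show "S \<subseteq> A" by fact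
    fix us ws assume "P @ K # rev Gs @ Q = us @ ws"
    then have "us @ ws = P @ (K # rev Gs) @ Q" by simp
    \<comment> \<open>Only prefixes ending inside the reversed block are new. Shorter ones are
      prefixes of \<open>hs\<close>, and longer ones have the same underlying set as a prefix of
      \<open>hs\<close>.\<close>
    then show "region (set us) \<noteq> {}"
    proof (cases rule: append_eq_append3_cases)
      case (1 z)
      then show ?thesis using crossing_order_prefix[OF co, of us "z @ Gs @ K # Q"] hs4 by simp
    next
      case (2 z z')
      show ?thesis
      proof (cases z)
        case Nil
        then show ?thesis using 2 crossing_order_prefix[OF co, of P "Gs @ K # Q"] hs4 by simp
      next
        case (Cons z0 G1)
        then show ?thesis using 2 prefix[of G1 z'] by simp
      qed
    next
      case (3 z z')
      then have "region (set (P @ Gs @ K # z)) \<noteq> {}"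
        using crossing_order_prefix[OF co, of "P @ Gs @ K # z" z'] hs4 by simp
      moreover have "set us = set (P @ Gs @ K # z)" using 3 by auto
      ultimately show ?thesis by simp
    qed
  qed
  moreover have "\<forall>h\<in>set Gs. lev h < lev K" using GPen lev by (auto simp: Pen_def i_def)
  ultimately show ?thesis using hs4 gG pen_eq pencil by blast
qed

section \<open>Intersections of codimension two\<close>

text \<open>The intersection is the orthogonal complement of the span of two independent
  normals.\<close>

lemma dim_Int_hyperplanes:
  assumes "H \<in> A" "H' \<in> A" "H \<noteq> H'"
  shows "dim (H \<inter> H') + 2 = DIM('a)"
proof -
  have nz: "N H \<noteq> 0" "N H' \<noteq> 0" using v_one assms by (metis inner_zero_left zero_neq_one)+
  have "N H \<notin> span {N H'}"
  proof
    assume "N H \<in> span {N H'}"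
    then obtain k where k: "N H = k *\<^sub>R N H'" by (auto simp: span_singleton)
    then have "k \<noteq> 0" using nz by auto
    then show False using k hyperplane_eq[OF assms(1)] hyperplane_eq[OF assms(2)] assms(3) by auto
  qed
  then have ind: "independent {N H, N H'}" and ne: "N H \<noteq> N H'"
    using nz by (auto simp: independent_insert span_base)
  have "H \<inter> H' = {y \<in> UNIV. \<forall>x \<in> span {N H, N H'}. orthogonal x y}"
  proof (intro equalityI subsetI)
    fix y assume "y \<in> H \<inter> H'"
    then have y: "N H \<bullet> y = 0" "N H' \<bullet> y = 0" using hyperplane_eq assms by blast+
    have "orthogonal x y" if "x \<in> span {N H, N H'}" for x
      using that y by (intro orthogonal_to_span[of x "{N H, N H'}" y, THEN orthogonal_commute[THEN iffD1]])
        (auto simp: orthogonal_def inner_commute)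
    then show "y \<in> {y \<in> UNIV. \<forall>x \<in> span {N H, N H'}. orthogonal x y}" by blast
  next
    fix y assume "y \<in> {y \<in> UNIV. \<forall>x \<in> span {N H, N H'}. orthogonal x y}"
    then have "N H \<bullet> y = 0" "N H' \<bullet> y = 0" by (auto simp: orthogonal_def span_base)
    then show "y \<in> H \<inter> H'" using hyperplane_eq assms by blast
  qed
  then have "dim (H \<inter> H') + dim (span {N H, N H'}) = dim (UNIV :: 'a set)"
    using dim_subspace_orthogonal_to_vectors[of "span {N H, N H'}" "UNIV :: 'a set"] by simp
  moreover have "dim (span {N H, N H'}) = 2"
    using ind ne by (simp add: dim_eq_card_independent)
  ultimately show ?thesis by simp
qed

lemma subspace_Lat:
  assumes "X \<in> Lat A"
  shows "subspace X"
proof -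
  obtain B where B: "B \<subseteq> A" "X = \<Inter>B" using assms by (auto simp: Lat_def)
  have "subspace H" if "H \<in> B" for H
    using that B(1) hyperplane_eq subspace_hyperplane by (metis subsetD)
  then show ?thesis unfolding B(2) by (intro subspace_Inter ballI)
qed

lemma Lcod_2_eq_Int:
  assumes "X \<in> Lcod A 2" "H \<in> A" "H' \<in> A" "H \<noteq> H'" "X \<subseteq> H" "X \<subseteq> H'"
  shows "X = H \<inter> H'"
proof (rule subspace_dim_equal)
  show "subspace X" using assms(1) subspace_Lat by (auto simp: Lcod_def)
  have "H \<inter> H' \<in> Lat A" using assms(2,3) unfolding Lat_def by (intro CollectI exI[of _ "{H, H'}"]) auto
  then show "subspace (H \<inter> H')" by (rule subspace_Lat)
  show "X \<subseteq> H \<inter> H'" using assms by blast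
  show "dim (H \<inter> H') \<le> dim X" using dim_Int_hyperplanes[OF assms(2-4)] assms(1) by (simp add: Lcod_def)
qed

lemma Int_in_Lcod_2: "H \<in> A \<Longrightarrow> H' \<in> A \<Longrightarrow> H \<noteq> H' \<Longrightarrow> H \<inter> H' \<in> Lcod A 2"
  using dim_Int_hyperplanes unfolding Lcod_def Lat_def
  by (intro CollectI conjI exI[of _ "{H, H'}"]) auto

text \<open>The flip changes the relative order only of pairs inside the block, and any such pair
  meets exactly in \<open>X\<close>. On \<open>X\<close> the flipped order agrees with
  \<open>hs0\<close>: both cross \<open>K\<close> first, and the order of the rest is then
  forced.\<close>

lemma flip_L2_gal:
  assumes hs0: "crossing_order S hs0" "level_sorted hs0"
    and hs: "crossing_order S hs" "\<not> level_sorted hs"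
  shows "\<exists>hs' X. crossing_order S hs' \<and>
    L2_gal A (region {}) (region S) (gallery_of hs') (gallery_of hs) = {X} \<and>
    L2_gal A (region {}) (region S) (gallery_of hs0) (gallery_of hs) =
      insert X (L2_gal A (region {}) (region S) (gallery_of hs0) (gallery_of hs')) \<and>
    X \<notin> L2_gal A (region {}) (region S) (gallery_of hs0) (gallery_of hs')"
proof -
  obtain P Gs K Q g where eq: "hs = P @ Gs @ K # Q" and co: "crossing_order S (P @ K # rev Gs @ Q)"
    and g: "g \<in> set Gs" and pen: "{H\<in>A. g \<inter> K \<subseteq> H} = insert K (set Gs)"
    and lev: "\<forall>h\<in>set Gs. lev h < lev K"
    and par: "\<forall>a\<in>set Gs. \<forall>b\<in>set Gs. a \<noteq> b \<longrightarrow> (\<exists>k. \<forall>x. N a \<bullet> x - N b \<bullet> x = k * (N K \<bullet> x))"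
    using flip_first_ascent[OF hs] by (elim exE conjE) (rule that)
  define hs' where "hs' = P @ K # rev Gs @ Q"
  define X where "X = g \<inter> K"
  have co': "crossing_order S hs'" using co by (simp add: hs'_def)
  have S: "distinct hs" "set hs = S" "S \<subseteq> A" "distinct hs0" "set hs0 = S" "distinct hs'" "set hs' = S"
    using hs hs0 co' by (auto simp: crossing_order_def)
  have KS: "K \<in> S" "K \<in> A" and GS: "\<And>h. h \<in> set Gs \<Longrightarrow> h \<in> S" using S eq by auto
  have gA: "g \<in> A" using GS[OF g] S by blast
  have gK: "g \<noteq> K" using lev g by auto
  have XL: "X \<in> Lcod A 2" unfolding X_def using Int_in_Lcod_2[OF gA KS(2) gK] .
  have Xsub: "{H\<in>A. X \<subseteq> H} \<subseteq> S" unfolding X_def pen using KS GS by blast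
  have mem: "H \<in> set Gs \<or> H = K" if "H \<in> A" "X \<subseteq> H" for H using that pen by (auto simp: X_def)
  have memX: "X \<subseteq> H \<and> H \<in> A" if "H \<in> set Gs \<or> H = K" for H using that pen by (auto simp: X_def)
  have order_eq: "precedes hs a b \<longleftrightarrow> precedes hs' a b"
    if "\<not> ((a \<in> set Gs \<or> a = K) \<and> (b \<in> set Gs \<or> b = K))" for a b
    using that precedes_in_set[of Gs a b] precedes_in_set[of Gs b a]
    by (auto simp: eq hs'_def precedes_append precedes_rev)
  have gKhs: "precedes hs g K" "precedes hs' K g" using g by (auto simp: eq hs'_def precedes_append)
  have gKhs0: "precedes hs0 K g"
    using level_sorted_precedes[OF hs0(2)] KS(1) GS[OF g] lev g S by auto
  have Yeq: "Y = X" if "Y \<in> Lcod A 2" "H \<in> A" "H' \<in> A" "H \<noteq> H'" "Y \<subseteq> H" "Y \<subseteq> H'"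
    "(H \<in> set Gs \<or> H = K) \<and> (H' \<in> set Gs \<or> H' = K)" for Y H H'
    using Lcod_2_eq_Int[OF that(1-6)] Lcod_2_eq_Int[OF XL that(2-4)] memX that(7) by auto
  have one: "L2_gal A (region {}) (region S) (gallery_of hs') (gallery_of hs) = {X}"
  proof (intro equalityI subsetI)
    fix Y assume "Y \<in> L2_gal A (region {}) (region S) (gallery_of hs') (gallery_of hs)"
    then obtain H H' where Y: "Y \<in> Lcod A 2"
      and H: "H \<in> A" "H' \<in> A" "H \<noteq> H'" "Y \<subseteq> H" "Y \<subseteq> H'" "precedes hs' H H'" "precedes hs H' H"
      unfolding L2_gal_iff[OF co' hs(1)] by blast
    have "(H \<in> set Gs \<or> H = K) \<and> (H' \<in> set Gs \<or> H' = K)"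
      using order_eq[of H' H] precedes_asym[OF S(6) H(6)] H(7) by blast
    then have "Y = X" by (rule Yeq[OF Y H(1-5)])
    then show "Y \<in> {X}" by simp
  next
    fix Y assume "Y \<in> {X}"
    then show "Y \<in> L2_gal A (region {}) (region S) (gallery_of hs') (gallery_of hs)"
      unfolding L2_gal_iff[OF co' hs(1)] using XL Xsub gKhs gK gA KS(2) X_def
      by (intro conjI bexI[of _ K] bexI[of _ g]) auto
  qed
  have in0: "X \<in> L2_gal A (region {}) (region S) (gallery_of hs0) (gallery_of hs)"
    unfolding L2_gal_iff[OF hs0(1) hs(1)]
    using XL Xsub gKhs gKhs0 gK gA KS(2) X_def by (intro conjI bexI[of _ K] bexI[of _ g]) auto
  have notin: "X \<notin> L2_gal A (region {}) (region S) (gallery_of hs0) (gallery_of hs')"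
  proof
    assume "X \<in> L2_gal A (region {}) (region S) (gallery_of hs0) (gallery_of hs')"
    then obtain H H' where H: "H \<in> A" "H' \<in> A" "H \<noteq> H'" "X \<subseteq> H" "X \<subseteq> H'"
      "precedes hs0 H H'" "precedes hs' H' H"
      unfolding L2_gal_iff[OF hs0(1) co'] by blast
    have K0: "precedes hs0 K h" and K': "precedes hs' K h" if "h \<in> set Gs" for h
      using that level_sorted_precedes[OF hs0(2), of K h] KS(1) GS[OF that] lev S
      by (auto simp: hs'_def precedes_append)
    have "H \<noteq> K" using H(7,2,3,5) mem K' precedes_asym[OF S(6)] by metis
    moreover have "H' \<noteq> K" using H(6,1,3,4) mem K0 precedes_asym[OF S(4)] by metis
    ultimately have G: "H \<in> set Gs" "H' \<in> set Gs" using H mem by blast+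
    then obtain k where k: "\<And>x. N H \<bullet> x - N H' \<bullet> x = k * (N K \<bullet> x)" using par H(3) by blast
    \<comment> \<open>Both \<open>hs0\<close> and \<open>hs'\<close> cross \<open>K\<close> before
      \<open>Gs\<close>, so opposite orders of \<open>H\<close> and \<open>H'\<close> would make
      \<open>k\<close> and \<open>- k\<close> positive.\<close>
    have k': "N H' \<bullet> x - N H \<bullet> x = (- k) * (N K \<bullet> x)" for x using k[of x] by simp
    show False
      using order_after_crossing[OF hs0(1) H(6) K0[OF G(1)] k]
        order_after_crossing[OF co' H(7) K'[OF G(2)] k'] by simp
  qed
  have "Y \<in> L2_gal A (region {}) (region S) (gallery_of hs0) (gallery_of hs) \<longleftrightarrow>
        Y \<in> L2_gal A (region {}) (region S) (gallery_of hs0) (gallery_of hs')" if "Y \<noteq> X" for Y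
  proof -
    have "precedes hs H' H \<longleftrightarrow> precedes hs' H' H"
      if "Y \<in> Lcod A 2" "H \<in> A" "H' \<in> A" "H \<noteq> H'" "Y \<subseteq> H" "Y \<subseteq> H'" for H H'
      using Yeq[OF that] order_eq[of H' H] \<open>Y \<noteq> X\<close> by blast
    then show ?thesis
      unfolding L2_gal_iff[OF hs0(1) hs(1)] L2_gal_iff[OF hs0(1) co'] by blast
  qed
  then have "L2_gal A (region {}) (region S) (gallery_of hs0) (gallery_of hs) =
      insert X (L2_gal A (region {}) (region S) (gallery_of hs0) (gallery_of hs'))"
    using in0 by (intro set_eqI) (metis insert_iff)
  then show ?thesis using co' one notin by (intro exI[of _ hs'] exI[of _ X] conjI)
qed

section \<open>Distances from the level-sorted gallery\<close>

text \<open>As long as \<open>hs\<close> is not sorted, a flip is an edge of \<open>G2\<close> that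
  removes exactly one element from the separation set. A sorted \<open>hs\<close> equals
  \<open>hs0\<close> by uniqueness. The walk lists vertices, hence the \<open>Suc\<close>.\<close>

lemma ex_G2_walk:
  assumes hs0: "crossing_order S hs0" "level_sorted hs0" and hs: "crossing_order S hs"
  shows "\<exists>ps. walk {r. min_gallery A (region {}) (region S) r} (G2_adj A (region {}) (region S)) ps \<and>
    hd ps = gallery_of hs0 \<and> last ps = gallery_of hs \<and>
    length ps = Suc (card (L2_gal A (region {}) (region S) (gallery_of hs0) (gallery_of hs)))"
  using hs
proof (induction "card (L2_gal A (region {}) (region S) (gallery_of hs0) (gallery_of hs))"
    arbitrary: hs rule: less_induct)
  case less
  have mg: "min_gallery A (region {}) (region S) (gallery_of hs)"
    using min_gallery_iff[OF hs0(1)] less.prems by blast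
  show ?case
  proof (cases "level_sorted hs")
    case True
    then have "hs = hs0" using level_sorted_unique hs0 less.prems by blast
    then show ?thesis using L2_gal_same[OF hs0(1)] mg
      by (intro exI[of _ "[gallery_of hs0]"]) (auto simp: walk_def)
  next
    case False
    obtain hs' X where hs': "crossing_order S hs'"
      "L2_gal A (region {}) (region S) (gallery_of hs') (gallery_of hs) = {X}"
      "L2_gal A (region {}) (region S) (gallery_of hs0) (gallery_of hs) =
        insert X (L2_gal A (region {}) (region S) (gallery_of hs0) (gallery_of hs'))"
      "X \<notin> L2_gal A (region {}) (region S) (gallery_of hs0) (gallery_of hs')"
      using flip_L2_gal[OF hs0 less.prems False] by (elim exE conjE) (rule that)
    have card: "card (L2_gal A (region {}) (region S) (gallery_of hs0) (gallery_of hs)) =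
      Suc (card (L2_gal A (region {}) (region S) (gallery_of hs0) (gallery_of hs')))"
      using hs'(3,4) finite_L2_gal by (metis card_insert_disjoint)
    obtain ps where ps: "walk {r. min_gallery A (region {}) (region S) r} (G2_adj A (region {}) (region S)) ps"
      "hd ps = gallery_of hs0" "last ps = gallery_of hs'"
      "length ps = Suc (card (L2_gal A (region {}) (region S) (gallery_of hs0) (gallery_of hs')))"
      using less.hyps[OF _ hs'(1)] card by auto
    have "ps \<noteq> []" using ps(4) by auto
    then have "walk {r. min_gallery A (region {}) (region S) r} (G2_adj A (region {}) (region S))
        (ps @ [gallery_of hs])" "hd (ps @ [gallery_of hs]) = gallery_of hs0"
      using ps mg hs'(2) by (simp_all add: walk_snoc G2_adj_def)
    then show ?thesis using ps(4) card by (intro exI[of _ "ps @ [gallery_of hs]"]) simp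
  qed
qed

lemma G2_dist_level_sorted:
  assumes hs0: "crossing_order S hs0" "level_sorted hs0" and hs: "crossing_order S hs"
  shows "G2_dist A (region {}) (region S) (gallery_of hs0) (gallery_of hs) =
    enat (card (L2_gal A (region {}) (region S) (gallery_of hs0) (gallery_of hs)))"
  unfolding G2_dist_def graph_dist_def
proof (rule antisym)
  let ?W = "{ps. walk {r. min_gallery A (region {}) (region S) r} (G2_adj A (region {}) (region S)) ps \<and>
    hd ps = gallery_of hs0 \<and> last ps = gallery_of hs}"
  let ?n = "card (L2_gal A (region {}) (region S) (gallery_of hs0) (gallery_of hs))"
  obtain ps where "ps \<in> ?W" "length ps = Suc ?n" using ex_G2_walk[OF assms] by blast
  then show "(INF ps\<in>?W. enat (length ps - 1)) \<le> enat ?n"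
    by (intro INF_lower2[of ps]) simp_all
  show "enat ?n \<le> (INF ps\<in>?W. enat (length ps - 1))"
  proof (rule INF_greatest)
    fix ps assume ps: "ps \<in> ?W"
    then show "enat ?n \<le> enat (length ps - 1)" using card_L2_gal_le_walk[OF hs0(1), of ps] by auto
  qed
qed

end

section \<open>From the modular flag to scaled normals\<close>

lemma ex_oriented_normals:
  assumes "\<And>H. H \<in> A \<Longrightarrow> linear_hyperplane H" "c \<in> chambers A"
  shows "\<exists>n. (\<forall>H\<in>A. H = {x. n H \<bullet> x = 0}) \<and> c = sign_region n A {}"
proof -
  obtain m where m: "\<And>H. H \<in> A \<Longrightarrow> H = {x. m H \<bullet> x = 0}"
    using assms(1) unfolding linear_hyperplane_def by metis
  then obtain T where T: "c = sign_region m A T"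
    using components_arrangement[of A m c] assms(2) unfolding chambers_def by metis
  define n where "n H = (if H \<in> T then - m H else m H)" for H
  have "H = {x. n H \<bullet> x = 0}" if "H \<in> A" for H
    unfolding n_def using m[OF that] by simp
  moreover have "c = sign_region n A {}"
    unfolding T sign_region_def n_def by (intro Collect_cong ball_cong) auto
  ultimately show ?thesis by blast
qed

lemma closure_sign_region_nonneg:
  assumes "x \<in> closure (sign_region n A {})" "H \<in> A"
  shows "0 \<le> n H \<bullet> x"
proof -
  have "sign_region n A {} \<subseteq> {x. n H \<bullet> x \<ge> 0}" using assms(2) by (auto simp: sign_region_def less_imp_le)
  then have "closure (sign_region n A {}) \<subseteq> {x. n H \<bullet> x \<ge> 0}"
    by (rule closure_minimal) (rule closed_halfspace_ge)
  then show ?thesis using assms(1) by blast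
qed

lemma modular_flag_mono:
  fixes A :: "'a::euclidean_space set set"
  assumes "modular_flag A F" "i \<le> j" "j \<le> DIM('a)"
  shows "F i \<subseteq> F j"
  using assms(2,3)
proof (induction j rule: dec_induct)
  case (step j)
  have "F (Suc j - 1) \<subset> F (Suc j)"
    using assms(1) step.prems unfolding modular_flag_def by (metis zero_less_Suc)
  then show ?case using step by auto
qed simp

lemma ex_flagged_arrangement:
  fixes A :: "'a::euclidean_space set set"
  assumes arr: "central_essential_arr A" and flag: "modular_flag A F"
    and c0: "c0 \<in> chambers A" and inc: "chamber_incident_flag c0 F"
  shows "\<exists>N lev v. flagged_arrangement A N lev v \<and> c0 = sign_region N A {} \<and>
    (\<forall>H\<in>A. \<forall>j\<le>DIM('a). F j \<subseteq> H \<longleftrightarrow> j \<le> lev H) \<and> (\<forall>H\<in>A. lev H < DIM('a))"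
proof -
  have fin: "finite A" and lin: "\<And>H. H \<in> A \<Longrightarrow> linear_hyperplane H"
    using arr by (auto simp: central_essential_arr_def)
  obtain n where n: "\<And>H. H \<in> A \<Longrightarrow> H = {x. n H \<bullet> x = 0}" and c0n: "c0 = sign_region n A {}"
    using ex_oriented_normals[OF lin c0] by blast
  have subH: "subspace H" if "H \<in> A" for H using n[OF that] subspace_hyperplane by metis
  have F0: "F 0 = {0}" and FU: "F DIM('a) = UNIV"
    and Fdim: "\<And>i. i \<le> DIM('a) \<Longrightarrow> dim (F i) = i"
    and FLat: "\<And>i. i \<le> DIM('a) \<Longrightarrow> F i \<in> Lat A"
    using flag unfolding modular_flag_def by auto
  have Fmod: "modular_rel A (F i) (F (Suc i))" if "i < DIM('a)" for i
    using flag that unfolding modular_flag_def by (metis Suc_leI diff_Suc_1 zero_less_Suc)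
  have Fsub: "subspace (F i)" if i: "i \<le> DIM('a)" for i
  proof -
    obtain B where B: "B \<subseteq> A" "F i = \<Inter>B" using FLat[OF i] by (auto simp: Lat_def)
    have "subspace H" if "H \<in> B" for H using that B(1) subH by blast
    then show ?thesis unfolding B(2) by (intro subspace_Inter ballI)
  qed
  \<comment> \<open>Otherwise the part of the closure of \<open>c0\<close> in
    \<open>F (Suc j)\<close> would have dimension at most \<open>j\<close>, against incidence with
    \<open>F (Suc j)\<close>.\<close>
  have "\<exists>u. u \<in> closure c0 \<and> u \<in> F (Suc j) \<and> u \<notin> F j" if j: "j < DIM('a)" for j
  proof (rule ccontr)
    assume "\<not> ?thesis"
    then have "closure c0 \<inter> F (Suc j) \<subseteq> F j" by blast
    then have "aff_dim (closure c0 \<inter> F (Suc j)) \<le> aff_dim (F j)" by (rule aff_dim_subset)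
    also have "\<dots> = int j" using aff_dim_subspace[OF Fsub] Fdim j by simp
    finally show False
      using inc j Fdim[of "Suc j"] by (simp add: chamber_incident_flag_def incident_def)
  qed
  then obtain v where v: "\<And>j. j < DIM('a) \<Longrightarrow> v j \<in> closure c0 \<and> v j \<in> F (Suc j) \<and> v j \<notin> F j"
    by metis
  have Fspan: "F (Suc j) = span (insert (v j) (F j))" if j: "j < DIM('a)" for j
  proof -
    have vj: "v j \<in> F (Suc j)" "v j \<notin> F j" using v[OF j] by auto
    have "span (F j) = F j" using Fsub[of j] j by (simp add: span_eq_iff)
    then have nsp: "v j \<notin> span (F j)" using vj by metis
    have "span (insert (v j) (F j)) \<subseteq> F (Suc j)"
      using vj modular_flag_mono[OF flag, of j "Suc j"] Fsub[of "Suc j"] j by (intro span_minimal) auto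
    moreover have "dim (F (Suc j)) \<le> dim (span (insert (v j) (F j)))"
      using nsp Fdim[of j] Fdim[of "Suc j"] j by (simp add: dim_insert)
    ultimately show ?thesis using Fsub[of "Suc j"] j
      by (intro subspace_dim_equal[symmetric]) auto
  qed
  \<comment> \<open>The maximum exists because \<open>F 0 = {0}\<close> lies in every hyperplane; it
    stays below the full dimension because \<open>F DIM('a)\<close> is the whole space.\<close>
  define lev where "lev H = Max {j. j \<le> DIM('a) \<and> F j \<subseteq> H}" for H
  have levmem: "lev H \<le> DIM('a) \<and> F (lev H) \<subseteq> H" if H: "H \<in> A" for H
  proof -
    have "0 \<in> {j. j \<le> DIM('a) \<and> F j \<subseteq> H}" using F0 subspace_0[OF subH[OF H]] by auto
    then have "lev H \<in> {j. j \<le> DIM('a) \<and> F j \<subseteq> H}"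
      unfolding lev_def by (intro Max_in) auto
    then show ?thesis by blast
  qed
  have levge: "j \<le> lev H" if "j \<le> DIM('a)" "F j \<subseteq> H" for j H
    unfolding lev_def using that by (intro Max_ge) auto
  have Flev: "F j \<subseteq> H \<longleftrightarrow> j \<le> lev H" if "H \<in> A" "j \<le> DIM('a)" for H j
    using levge[OF that(2)] levmem[OF that(1)] modular_flag_mono[OF flag, of j "lev H"] by blast
  have levlt: "lev H < DIM('a)" if H: "H \<in> A" for H
  proof (rule ccontr)
    assume "\<not> ?thesis"
    then have "H = UNIV" using levmem[OF H] FU by (metis le_neq_implies_less top.extremum_uniqueI)
    moreover obtain m where "m \<noteq> 0" "H = {x. m \<bullet> x = 0}" using lin[OF H] by (auto simp: linear_hyperplane_def)
    ultimately have "m \<bullet> m = 0" by blast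
    then show False using \<open>m \<noteq> 0\<close> by simp
  qed
  have nonneg: "0 \<le> n H \<bullet> v j" if "H \<in> A" "j < DIM('a)" for H j
    using closure_sign_region_nonneg[of "v j" n A H] v[OF that(2)] that(1) c0n by blast
  \<comment> \<open>If \<open>v (lev H)\<close> lay in \<open>H\<close>, then \<open>H\<close> would
    contain the span \<open>F (Suc (lev H))\<close>, contrary to maximality of the level.\<close>
  have pos: "0 < n H \<bullet> v (lev H)" if H: "H \<in> A" for H
  proof (rule ccontr)
    assume "\<not> ?thesis"
    then have "n H \<bullet> v (lev H) = 0" using nonneg[OF H levlt[OF H]] by simp
    then have "v (lev H) \<in> H" using n[OF H] by blast
    then have "F (Suc (lev H)) \<subseteq> H"
      unfolding Fspan[OF levlt[OF H]] using levmem[OF H] subH[OF H] by (intro span_minimal) auto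
    then show False using Flev[OF H, of "Suc (lev H)"] levlt[OF H] by auto
  qed
  define N where "N H = (1 / (n H \<bullet> v (lev H))) *\<^sub>R n H" for H
  have Ninner: "N H \<bullet> x = (n H \<bullet> x) / (n H \<bullet> v (lev H))" for H x by (simp add: N_def)
  have N: "H = {x. N H \<bullet> x = 0}" if H: "H \<in> A" for H
    using n[OF H] pos[OF H] by (simp add: Ninner)
  have c0N: "c0 = sign_region N A {}"
    unfolding c0n sign_region_def using pos by (intro Collect_cong ball_cong) (auto simp: Ninner zero_less_divide_iff dest: less_asym)
  have ne: "c0 \<noteq> {}" using c0 in_components_nonempty unfolding chambers_def by blast
  have one: "N H \<bullet> v (lev H) = 1" if "H \<in> A" for H using pos[OF that] by (simp add: Ninner)
  have "flagged_arrangement A N lev v"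
  proof
    show "finite A" by fact
    show "H = {x. N H \<bullet> x = 0}" if "H \<in> A" for H by (rule N[OF that])
    show "sign_region N A {} \<noteq> {}" using ne c0N by simp
    show "N H \<bullet> v j = 0" if "H \<in> A" "j < lev H" for H j
    proof -
      have "v j \<in> F (Suc j)" using v[of j] that levlt[OF that(1)] by simp
      then have "v j \<in> H" using Flev[OF that(1), of "Suc j"] that levlt[OF that(1)] by auto
      then show ?thesis using N[OF that(1)] by blast
    qed
    show "N H \<bullet> v (lev H) = 1" if "H \<in> A" for H by (rule one[OF that])
    show "0 \<le> N H \<bullet> v (lev H')" if "H \<in> A" "H' \<in> A" for H H'
      using nonneg[OF that(1) levlt[OF that(2)]] pos[OF that(1)] by (simp add: Ninner)
    show "\<exists>K\<in>A. lev H < lev K \<and> (\<exists>k. N H - N H' = k *\<^sub>R N K)"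
      if H: "H \<in> A" "H' \<in> A" "H \<noteq> H'" "lev H = lev H'" for H H'
    proof -
      define i where "i = lev H"
      \<comment> \<open>This is the hyperplane provided by modularity of \<open>F (Suc i)\<close>
        over \<open>F i\<close>. It contains \<open>F (Suc i)\<close>, so its level is
        higher.\<close>
      define K where "K = {z + w | z w. z \<in> F (Suc i) \<and> w \<in> H \<inter> H'}"
      have i: "i < DIM('a)" using levlt[OF H(1)] by (simp add: i_def)
      have "F i \<subseteq> H" "F i \<subseteq> H'" "\<not> F (Suc i) \<subseteq> H" "\<not> F (Suc i) \<subseteq> H'"
        using Flev[OF H(1)] Flev[OF H(2)] i H(4) by (auto simp: i_def)
      then have KA: "K \<in> A" using Fmod[OF i] H(1-3) unfolding modular_rel_def K_def by blast
      have "0 \<in> H \<inter> H'" using subspace_0 subH H by blast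
      then have "F (Suc i) \<subseteq> K" unfolding K_def by force
      then have lt: "lev H < lev K" using Flev[OF KA, of "Suc i"] i by (simp add: i_def)
      \<comment> \<open>A vector of \<open>K\<close> is a multiple of \<open>v i\<close>, plus an
        element of \<open>F i\<close>, plus an element of \<open>H \<inter> H'\<close>. The last two
        are killed by both normals, and the scaling makes the normals agree on
        \<open>v i\<close>.\<close>
      have "(N H - N H') \<bullet> x = 0" if "N K \<bullet> x = 0" for x
      proof -
        have "x \<in> K" using N[OF KA] that by blast
        then obtain z w where x: "x = z + w" "z \<in> F (Suc i)" "w \<in> H" "w \<in> H'" unfolding K_def by blast
        have "z \<in> span (insert (v i) (F i))" using x(2) Fspan[OF i] by simp
        then obtain k where "z - k *\<^sub>R v i \<in> span (F i)" by (auto simp: span_breakdown_eq)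
        then have "z - k *\<^sub>R v i \<in> F i" using Fsub[of i] i by (simp add: span_eq_iff[THEN iffD2])
        then have "z - k *\<^sub>R v i \<in> H" "z - k *\<^sub>R v i \<in> H'" using \<open>F i \<subseteq> H\<close> \<open>F i \<subseteq> H'\<close> by auto
        then have "N H \<bullet> (z - k *\<^sub>R v i) = 0" "N H' \<bullet> (z - k *\<^sub>R v i) = 0" "N H \<bullet> w = 0" "N H' \<bullet> w = 0"
          using N[OF H(1)] N[OF H(2)] x by blast+
        moreover have "N H \<bullet> v i = 1" "N H' \<bullet> v i = 1" using one[OF H(1)] one[OF H(2)] H(4) by (simp_all add: i_def)
        ultimately show ?thesis by (simp add: x(1) inner_diff_left inner_diff_right inner_add_right)
      qed
      then have "\<exists>k. N H - N H' = k *\<^sub>R N K" by (rule parallel_if_vanishes)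
      then show ?thesis using KA lt by blast
    qed
  qed
  then show ?thesis using c0N Flev levlt by blast
qed

text \<open>Failure of \<open>F j \<subseteq> H'\<close> means that \<open>H'\<close> has level
  below \<open>j\<close>, so incidence to the flag asks precisely that higher levels be crossed
  before lower ones.\<close>

lemma (in flagged_arrangement) gallery_incident_flag_iff:
  assumes co: "crossing_order S hs"
    and lev: "\<And>H j. H \<in> A \<Longrightarrow> j \<le> DIM('a) \<Longrightarrow> F j \<subseteq> H \<longleftrightarrow> j \<le> lev H" "\<And>H. H \<in> A \<Longrightarrow> lev H < DIM('a)"
  shows "gallery_incident_flag A (region {}) (region S) F (gallery_of hs) \<longleftrightarrow> level_sorted hs"
proof -
  have S: "S \<subseteq> A" "set hs = S" "distinct hs" using co by (auto simp: crossing_order_def)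
  have "region S \<noteq> {}" using crossing_order_prefix[OF co, of hs "[]"] S by simp
  then have L1: "L1 A (region {}) (region S) = S" using L1_region[of "{}" S] base_nonempty S by auto
  show ?thesis
  proof
    assume inc: "gallery_incident_flag A (region {}) (region S) F (gallery_of hs)"
    show "level_sorted hs"
    proof (rule sorted_wrt_if_precedes, rule ccontr)
      fix a b assume ab: "precedes hs a b" "\<not> lev b \<le> lev a"
      have m: "a \<in> S" "b \<in> S" "a \<in> A" "b \<in> A" using precedes_in_set[OF ab(1)] S by auto
      \<comment> \<open>At an ascent the incidence condition is applied with the levels of
        \<open>a\<close> and \<open>b\<close> as flag indices.\<close>
      have "crosses_before A (gallery_of hs) b a"
        using inc[unfolded gallery_incident_flag_def L1, rule_format, of "lev a" "lev b" b a]
          m ab(2) lev(1)[of a] lev(1)[of b] lev(2)[of a] lev(2)[of b] by auto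
      then show False using precedes_asym[OF S(3) ab(1)] crosses_before_gallery_of[OF co] by simp
    qed
  next
    assume sorted: "level_sorted hs"
    show "gallery_incident_flag A (region {}) (region S) F (gallery_of hs)"
      unfolding gallery_incident_flag_def L1
    proof (intro allI impI)
      fix i j :: nat and H H' assume a: "i < j" "j \<le> DIM('a)" "H \<in> S" "F j \<subseteq> H" "H' \<in> S" "F i \<subseteq> H'" "\<not> F j \<subseteq> H'"
      then have "H \<in> A" "H' \<in> A" using S by auto
      then have "lev H' < lev H" using a lev(1)[of H j] lev(1)[of H' j] by simp
      then have "precedes hs H H'" using level_sorted_precedes[OF sorted] a S by blast
      then show "crosses_before A (gallery_of hs) H H'" using crosses_before_gallery_of[OF co] by simp
    qed
  qed
qed

theorem theorem5p5:
  fixes A :: "'a::euclidean_space set set"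
    and F :: "nat \<Rightarrow> 'a set"
    and c0 c :: "'a set"
  assumes "central_essential_arr A"
    and "supersolvable A"
    and "modular_flag A F"
    and "c0 \<in> chambers A" and "chamber_incident_flag c0 F"
    and "c \<in> chambers A" and "c \<noteq> c0"
  shows "(\<exists>!r0. min_gallery A c0 c r0 \<and> gallery_incident_flag A c0 c F r0) \<and>
         (\<forall>r0. min_gallery A c0 c r0 \<and> gallery_incident_flag A c0 c F r0 \<longrightarrow>
            (\<forall>r. min_gallery A c0 c r \<longrightarrow> G2_dist A c0 c r0 r = enat (card (L2_gal A c0 c r0 r))))"
proof -
  obtain N lev v where fa: "flagged_arrangement A N lev v" and c0: "c0 = sign_region N A {}"
    and lev: "\<And>H j. H \<in> A \<Longrightarrow> j \<le> DIM('a) \<Longrightarrow> F j \<subseteq> H \<longleftrightarrow> j \<le> lev H" "\<And>H. H \<in> A \<Longrightarrow> lev H < DIM('a)"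
    using ex_flagged_arrangement[OF assms(1,3,4,5)] by blast
  interpret flagged_arrangement A N lev v by (rule fa)
  obtain S where S: "S \<subseteq> A" "c = region S" "region S \<noteq> {}" using assms(6) by (rule chamber_region)
  obtain hs0 where hs0: "crossing_order S hs0" "level_sorted hs0"
    using ex_level_sorted_crossing_order[OF S(1,3)] by blast
  \<comment> \<open>This one equivalence gives existence and uniqueness, and reduces the distance
    claim to \<open>gallery_of hs0\<close>.\<close>
  have char: "min_gallery A c0 c r \<and> gallery_incident_flag A c0 c F r \<longleftrightarrow> r = gallery_of hs0" for r
    unfolding c0 S(2) min_gallery_iff[OF hs0(1)]
    using gallery_incident_flag_iff[where F = F, OF _ lev] hs0 level_sorted_unique by metis
  have "G2_dist A c0 c (gallery_of hs0) r = enat (card (L2_gal A c0 c (gallery_of hs0) r))"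
    if "min_gallery A c0 c r" for r
  proof -
    obtain hs where "crossing_order S hs" "r = gallery_of hs"
      using \<open>min_gallery A c0 c r\<close> min_gallery_iff[OF hs0(1)] unfolding c0 S(2) by blast
    then show ?thesis using G2_dist_level_sorted[OF hs0] unfolding c0 S(2) by simp
  qed
  then show ?thesis unfolding char by simp
qed

end
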